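(* Let $f:\mathbb{R}^n\to\mathbb{R}$ be twice continuously differentiable, with $L_g$-Lipschitz continuous gradient and $L_H$-Lipschitz continuous Hessian on $\mathbb{R}^n$, and bounded below by a scalar $\bar f\in\mathbb{R}$. Let the Stochastic Two-Step Method (defined in the context) be run under the stochastic conditions (A), (B), (C) stated in the context, with parameters $\gamma\in(0,1]$, $\gamma_H\in[0,\gamma)$, $\gamma_\lambda\in[0,1)$, $\gamma_H<\gamma(1-\gamma_\lambda)$, $\delta\in(0,\infty)$, constant $\theta_k=\theta\in[0,1)$ and $\hat\theta_k=\hat\theta\in[0,\infty)$, and $\sigma_k>0$, $\hat\sigma_k>0$ with $\sum_{k=0}^\infty\sigma_k^2<\infty$ and $\sum_{k=0}^\infty\hat\sigma_k^2<\infty$. Let the step sizes be constant, $\alpha_k=\alpha$ and $\beta_k=\beta$, with $$0<\alpha\le\frac{1}{L_g(1+\hat\theta^2)}\qquad\text{and}\qquad 0<\beta\le\frac{3\left(\gamma-\frac{\gamma_H}{1-\gamma_\lambda}\right)}{2\delta L_H}.$$ Consider any scalars $\epsilon_g,\epsilon_H>0$. Then the cardinality of the index set $\mathcal{G}(\epsilon_g):=\{k\in\mathbb{N}:\mathbb{E}[\|\nabla f(x_k)\|_2]>\epsilon_g\}$ is at most $\mathcal{O}(\epsilon_g^{-2})$, and the cardinality of the index set $\mathcal{H}(\epsilon_H):=\{k\in\mathbb{N}:\mathbb{E}[|\lambda_{\min,k}^-|]>\epsilon_H\}$ is at most $\mathcal{O}(\epsilon_H^{-3})$. Hence, the number of iterations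 required until an iteration $k\in\mathbb{N}$ is reached with $\mathbb{E}[\|\nabla f(x_k)\|_2]\le\epsilon_g$ and $\mathbb{E}[\lambda_{\min}(\nabla^2 f(x_k))]\ge-\epsilon_H$ is at most $\mathcal{O}(\max\{\epsilon_g^{-2},\epsilon_H^{-3}\})$.
   Context: Setting: $f(x)=\mathbb{E}_\xi[F(x,\xi)]$ for a random variable $\xi$; only stochastic approximations of the gradient and Hessian are available. $\lambda_{\min}(A)$ denotes the left-most (smallest) eigenvalue of a symmetric matrix $A$. $\mathbb{N}=\{0,1,2,\dots\}$. The $\mathcal{O}(\cdot)$ notation refers to small tolerances $\epsilon_g,\epsilon_H$, with constants independent of $\epsilon_g,\epsilon_H$. Stochastic Two-Step Method. Given $x_0\in\mathbb{R}^n$ and step sizes $\alpha_k>0$, $\beta_k>0$, for $k=0,1,2,\dots$: 1. Compute a (symmetric, random) Hessian approximation $H_k$ of $\nabla^2 f(x_k)$, with left-most eigenvalue $\lambda_k$, such that condition (B) holds. If $\lambda_k\ge0$ set $p_k=0$; otherwise compute $q_k$ and set $p_k$ using condition (A). 2. Set $\hat x_k=x_k+\beta_kp_k$. 3. Compute a (random) gradient approximation $\hat g_k$ at $\hat x_k$ satisfying condition (C), and set $d_k=-\hat g_k$. 4. Set $x_{k+1}=\hat x_k+\alpha_kd_k=x_k+\beta_kp_k+\alpha_kd_k$. There is no termination test. Conditional expectations: $\mathcal{F}_k=\sigma(x_0,\dots,x_k)$, $\mathbb{E}_k[\cdot]=\mathbb{E}[\cdot\mid\mathcal{F}_k]$,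 $\mathbb{E}_{\hat k}[\cdot]=\mathbb{E}[\cdot\mid\mathcal{F}_k,\hat x_k]$, $\mathbb{E}_{k,q}[\cdot]=\mathbb{E}[\cdot\mid\mathcal{F}_k,q_k]$; $\mathbb{E}$ is the total expectation. Write $\lambda_k^-:=\min\{\lambda_k,0\}$ and $\lambda_{\min,k}^-:=\min\{\lambda_{\min}(\nabla^2 f(x_k)),0\}$. Conditions, required for all $k\in\mathbb{N}$: (A) If $\lambda_k\ge0$, then $p_k=0$ (and one takes $q_k=0$). Otherwise $p_k=q_k$ if $g_k^{\mathsf T}q_k\le0$ and $p_k=-q_k$ otherwise, where $q_k$ satisfies $q_k^{\mathsf T}H_kq_k\le\gamma\lambda_k\|q_k\|_2^2<0$ and $\|q_k\|_2=\delta|\lambda_k|$. The (random) approximation $g_k$ of $\nabla f(x_k)$ satisfies $\mathbb{E}_{k,q}[|(g_k-\nabla f(x_k))^{\mathsf T}q_k|]\le\theta_k^2\,\mathbb{E}_{k,q}[|g_k^{\mathsf T}q_k|]+\sigma_k^2$. (B) $\mathbb{E}_k[\|(H_k-\nabla^2 f(x_k))p_k\|_2^2]\le\gamma_H^2|\lambda_{\min,k}^-|^2\,\mathbb{E}_k[\|p_k\|_2^2]$ and $\mathbb{E}_k[|\lambda_k^--\lambda_{\min,k}^-|]\le\gamma_\lambda|\lambda_{\min,k}^-|$. (C) $\mathbb{E}_{\hat k}[\hat g_k]=\nabla f(\hat x_k)$ and $\mathbb{E}_{\hat k}[\|\hat g_k-\nabla f(\hat x_k)\|_2^2]\le\hat\theta_k^2\|\nabla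 f(\hat x_k)\|_2^2+\hat\sigma_k^2$. *)

theory Defs
  imports "HOL-Probability.Probability"
begin

section \<open>Gradient, Hessian, left-most eigenvalue\<close>

definition gradient :: "(real^'n \<Rightarrow> real) \<Rightarrow> real^'n \<Rightarrow> real^'n" where
  "gradient f x = (THE D. GDERIV f x :> D)"

definition hessian :: "(real^'n \<Rightarrow> real) \<Rightarrow> real^'n \<Rightarrow> real^'n^'n" where
  "hessian f x = jacobian (gradient f) (at x)"

definition twice_continuously_differentiable :: "(real^'n \<Rightarrow> real) \<Rightarrow> bool" where
  "twice_continuously_differentiable f \<longleftrightarrow>
     f differentiable_on UNIV \<and> gradient f differentiable_on UNIV \<and>
     continuous_on UNIV (hessian f)"

text \<open>The library norm on matrices is the Frobenius norm. The Hessian is Lipschitz with respect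
  to the spectral norm, i.e. the operator norm induced by the Euclidean norm, which is why
  \<open>onorm\<close> is used here instead of \<open>lipschitz_on\<close>.\<close>

definition hessian_lipschitz :: "real \<Rightarrow> (real^'n \<Rightarrow> real) \<Rightarrow> bool" where
  "hessian_lipschitz L f \<longleftrightarrow>
     (\<forall>x y. onorm (\<lambda>v. (hessian f x - hessian f y) *v v) \<le> L * norm (x - y))"

text \<open>Only meaningful for symmetric matrices, for which the set of real eigenvalues is finite and
  nonempty.\<close>

definition lambda_min :: "real^'n^'n \<Rightarrow> real" where
  "lambda_min A = Min {l. \<exists>v. v \<noteq> 0 \<and> A *v v = l *\<^sub>R v}"

definition lambda_min_neg :: "real^'n^'n \<Rightarrow> real" where
  "lambda_min_neg A = min (lambda_min A) 0"


section \<open>Generated sigma-algebras\<close>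

definition sigma_of :: "'w measure \<Rightarrow> ('w \<Rightarrow> 'a::topological_space) set \<Rightarrow> 'w measure" where
  "sigma_of M S = sigma (space M) {X -` A \<inter> space M | X A. X \<in> S \<and> A \<in> sets borel}"

definition F_k :: "'w measure \<Rightarrow> (nat \<Rightarrow> 'w \<Rightarrow> real^'n) \<Rightarrow> nat \<Rightarrow> 'w measure" where
  "F_k M x k = sigma_of M (x ` {..k})"

definition F_k_and :: "'w measure \<Rightarrow> (nat \<Rightarrow> 'w \<Rightarrow> real^'n) \<Rightarrow> nat \<Rightarrow> ('w \<Rightarrow> real^'n) \<Rightarrow> 'w measure"
  where "F_k_and M x k Y = sigma_of M (insert Y (x ` {..k}))"


section \<open>The method and its stochastic conditions\<close>

text \<open>The iterates \<open>x\<close>, \<open>xhat\<close> and the steps are driven by the random quantities \<open>H\<close> (Hessian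
  approximations), \<open>ghat\<close> (gradient approximations at \<open>xhat\<close>) and, through \<open>condition_A\<close>,
  \<open>g\<close> and \<open>q\<close>. The starting point is deterministic. The step \<open>d k\<close> is \<open>- ghat k\<close>.
  Here \<open>p\<close> is arbitrary; it is determined by \<open>condition_A\<close>.\<close>

definition two_step_method ::
  "'w measure \<Rightarrow> (nat \<Rightarrow> real) \<Rightarrow> (nat \<Rightarrow> real) \<Rightarrow> real^'n \<Rightarrow>
   (nat \<Rightarrow> 'w \<Rightarrow> real^'n^'n) \<Rightarrow> (nat \<Rightarrow> 'w \<Rightarrow> real^'n) \<Rightarrow> (nat \<Rightarrow> 'w \<Rightarrow> real^'n) \<Rightarrow>
   (nat \<Rightarrow> 'w \<Rightarrow> real^'n) \<Rightarrow> (nat \<Rightarrow> 'w \<Rightarrow> real^'n) \<Rightarrow> bool"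
where
  "two_step_method M \<alpha> \<beta> x0 H p ghat xhat x \<longleftrightarrow>
     (\<forall>k. H k \<in> borel_measurable M \<and> ghat k \<in> borel_measurable M) \<and>
     (\<forall>k. \<alpha> k > 0 \<and> \<beta> k > 0) \<and>
     (\<forall>\<omega>\<in>space M. x 0 \<omega> = x0) \<and>
     (\<forall>k. \<forall>\<omega>\<in>space M.
        transpose (H k \<omega>) = H k \<omega> \<and>
        xhat k \<omega> = x k \<omega> + \<beta> k *\<^sub>R p k \<omega> \<and>
        x (Suc k) \<omega> = xhat k \<omega> + \<alpha> k *\<^sub>R (- ghat k \<omega>))"

text \<open>Conditional expectations of nonnegative quantities are taken in the extended sense of
  \<open>nn_cond_exp\<close>, so that no integrability is needed for the quantity being bounded. The
  integrability requirement in each of the three conditions makes explicit that the conditional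
  expectation on the bounding side, respectively of \<open>ghat k\<close>, is a genuine (finite) one; with
  an infinite bounding side the conditions would be void.\<close>

definition condition_A ::
  "'w measure \<Rightarrow> (real^'n \<Rightarrow> real) \<Rightarrow> real \<Rightarrow> real \<Rightarrow> (nat \<Rightarrow> real) \<Rightarrow> (nat \<Rightarrow> real) \<Rightarrow>
   (nat \<Rightarrow> 'w \<Rightarrow> real^'n^'n) \<Rightarrow> (nat \<Rightarrow> 'w \<Rightarrow> real^'n) \<Rightarrow> (nat \<Rightarrow> 'w \<Rightarrow> real^'n) \<Rightarrow>
   (nat \<Rightarrow> 'w \<Rightarrow> real^'n) \<Rightarrow> (nat \<Rightarrow> 'w \<Rightarrow> real^'n) \<Rightarrow> bool"
where
  "condition_A M f \<gamma> \<delta> \<theta> \<sigma> H g q p x \<longleftrightarrow>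
     (\<forall>k. g k \<in> borel_measurable M \<and> q k \<in> borel_measurable M) \<and>
     (\<forall>k. \<forall>\<omega>\<in>space M.
        (if lambda_min (H k \<omega>) \<ge> 0 then q k \<omega> = 0 \<and> p k \<omega> = 0
         else q k \<omega> \<bullet> (H k \<omega> *v q k \<omega>) \<le> \<gamma> * lambda_min (H k \<omega>) * (norm (q k \<omega>))\<^sup>2 \<and>
              \<gamma> * lambda_min (H k \<omega>) * (norm (q k \<omega>))\<^sup>2 < 0 \<and>
              norm (q k \<omega>) = \<delta> * \<bar>lambda_min (H k \<omega>)\<bar> \<and>
              p k \<omega> = (if g k \<omega> \<bullet> q k \<omega> \<le> 0 then q k \<omega> else - q k \<omega>))) \<and>
     (\<forall>k. integrable M (\<lambda>\<omega>. g k \<omega> \<bullet> q k \<omega>)) \<and>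
     (\<forall>k. AE \<omega> in M.
        nn_cond_exp M (F_k_and M x k (q k))
          (\<lambda>\<omega>. ennreal \<bar>(g k \<omega> - gradient f (x k \<omega>)) \<bullet> q k \<omega>\<bar>) \<omega>
        \<le> ennreal ((\<theta> k)\<^sup>2) * nn_cond_exp M (F_k_and M x k (q k))
              (\<lambda>\<omega>. ennreal \<bar>g k \<omega> \<bullet> q k \<omega>\<bar>) \<omega>
          + ennreal ((\<sigma> k)\<^sup>2))"

definition condition_B ::
  "'w measure \<Rightarrow> (real^'n \<Rightarrow> real) \<Rightarrow> real \<Rightarrow> real \<Rightarrow>
   (nat \<Rightarrow> 'w \<Rightarrow> real^'n^'n) \<Rightarrow> (nat \<Rightarrow> 'w \<Rightarrow> real^'n) \<Rightarrow> (nat \<Rightarrow> 'w \<Rightarrow> real^'n) \<Rightarrow> bool"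
where
  "condition_B M f \<gamma>H \<gamma>l H p x \<longleftrightarrow>
     (\<forall>k. integrable M (\<lambda>\<omega>. (norm (p k \<omega>))\<^sup>2)) \<and>
     (\<forall>k. AE \<omega> in M.
        nn_cond_exp M (F_k M x k)
          (\<lambda>\<omega>. ennreal ((norm ((H k \<omega> - hessian f (x k \<omega>)) *v p k \<omega>))\<^sup>2)) \<omega>
        \<le> ennreal (\<gamma>H\<^sup>2 * \<bar>lambda_min_neg (hessian f (x k \<omega>))\<bar>\<^sup>2)
          * nn_cond_exp M (F_k M x k) (\<lambda>\<omega>. ennreal ((norm (p k \<omega>))\<^sup>2)) \<omega>) \<and>
     (\<forall>k. AE \<omega> in M.
        nn_cond_exp M (F_k M x k)
          (\<lambda>\<omega>. ennreal \<bar>lambda_min_neg (H k \<omega>) - lambda_min_neg (hessian f (x k \<omega>))\<bar>) \<omega>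
        \<le> ennreal (\<gamma>l * \<bar>lambda_min_neg (hessian f (x k \<omega>))\<bar>))"

text \<open>\<open>real_cond_exp\<close> is real-valued only, so the conditional expectation of the vector
  \<open>ghat k\<close> is expressed componentwise.\<close>

definition condition_C ::
  "'w measure \<Rightarrow> (real^'n \<Rightarrow> real) \<Rightarrow> (nat \<Rightarrow> real) \<Rightarrow> (nat \<Rightarrow> real) \<Rightarrow>
   (nat \<Rightarrow> 'w \<Rightarrow> real^'n) \<Rightarrow> (nat \<Rightarrow> 'w \<Rightarrow> real^'n) \<Rightarrow> (nat \<Rightarrow> 'w \<Rightarrow> real^'n) \<Rightarrow> bool"
where
  "condition_C M f \<theta>hat \<sigma>hat ghat xhat x \<longleftrightarrow>
     (\<forall>k. integrable M (ghat k)) \<and>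
     (\<forall>k i. AE \<omega> in M.
        real_cond_exp M (F_k_and M x k (xhat k)) (\<lambda>\<omega>. ghat k \<omega> $ i) \<omega>
        = gradient f (xhat k \<omega>) $ i) \<and>
     (\<forall>k. AE \<omega> in M.
        nn_cond_exp M (F_k_and M x k (xhat k))
          (\<lambda>\<omega>. ennreal ((norm (ghat k \<omega> - gradient f (xhat k \<omega>)))\<^sup>2)) \<omega>
        \<le> ennreal ((\<theta>hat k)\<^sup>2 * (norm (gradient f (xhat k \<omega>)))\<^sup>2 + (\<sigma>hat k)\<^sup>2))"


section \<open>Index sets\<close>

text \<open>Total expectations of nonnegative quantities are nonnegative integrals, with values in
  \<open>[0, \<infinity>]\<close>: an infinite expectation counts as exceeding the tolerance, whereas the Bochner
  integral of a non-integrable function would be 0.\<close>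

definition G_index ::
  "'w measure \<Rightarrow> (real^'n \<Rightarrow> real) \<Rightarrow> (nat \<Rightarrow> 'w \<Rightarrow> real^'n) \<Rightarrow> real \<Rightarrow> nat set" where
  "G_index M f x \<epsilon> = {k. (\<integral>\<^sup>+\<omega>. ennreal (norm (gradient f (x k \<omega>))) \<partial>M) > ennreal \<epsilon>}"

definition H_index ::
  "'w measure \<Rightarrow> (real^'n \<Rightarrow> real) \<Rightarrow> (nat \<Rightarrow> 'w \<Rightarrow> real^'n) \<Rightarrow> real \<Rightarrow> nat set" where
  "H_index M f x \<epsilon> =
     {k. (\<integral>\<^sup>+\<omega>. ennreal \<bar>lambda_min_neg (hessian f (x k \<omega>))\<bar> \<partial>M) > ennreal \<epsilon>}"

end

theory Submission
  imports Defs
begin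

text \<open>
Each of the two steps of the method decreases the expected objective, up to summable noise, by an
amount that measures how far the iterate is from second-order stationarity. Since the objective is
bounded below, these amounts have finite sums, and a finite sum leaves room for only finitely many
large terms.

The curvature step is analysed with the cubic Taylor bound (\<open>hessian_taylor_upper\<close>). The slope along
\<open>p\<close> is nonpositive up to \<open>(\<sigma> k)\<^sup>2\<close> in the mean. Let \<open>m\<close> be the size of the negative part of the
left-most eigenvalue of the Hessian and \<open>t\<close> the one of its estimate. Then \<open>p\<close> has length
\<open>\<delta> t\<close>, so the quadratic term gains a multiple of \<open>t\<^sup>3\<close>, reduced by the Hessian error. A conditional
Cauchy-Schwarz inequality bounds the mean of this error by a multiple of the mean of \<open>m t\<^sup>2\<close>
(\<open>conditional_cauchy_schwarz\<close>). Since the conditional mean of \<open>t\<close> is at least \<open>(1 - \<gamma>l) m\<close>, both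
\<open>(1 - \<gamma>l) m t\<^sup>2\<close> and \<open>(1 - \<gamma>l)\<^sup>3 m\<^sup>3\<close> have a mean of at most that of \<open>t\<^sup>3\<close> (\<open>third_moment_bounds\<close>).
Hence the step decreases the expected objective by a multiple of the mean of \<open>m\<^sup>3\<close>
(\<open>curvature_step\<close>).

The gradient step is an unbiased stochastic gradient step from \<open>xhat k\<close> and decreases the expected
objective by a multiple of the mean squared gradient at \<open>xhat k\<close> (\<open>gradient_step\<close>). This gradient
also controls the one at \<open>x (Suc k)\<close> (\<open>next_gradient_moment\<close>), so the mean squared gradients at the
iterates are summable as well.

An index in \<open>G_index\<close> contributes at least \<open>\<epsilon>g\<^sup>2\<close> to the second sum and an index in \<open>H_index\<close> at
least \<open>\<epsilon>H\<^sup>3\<close> to the first one (\<open>power_le_expectation_power\<close>), and counting gives the claims.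

All random quantities are controlled by induction along the run: integrability of \<open>f (x k)\<close> yields
that of \<open>f (xhat k)\<close> and of the decrease, and then that of \<open>f (x (Suc k))\<close>. Measurability of the
curvature needs that the left-most eigenvalue of the Hessian depends continuously on the point,
which rests on the symmetry of the Hessian (\<open>hessian_symmetric\<close>) and the variational
characterization of the eigenvalue (\<open>lambda_min_rayleigh\<close>).
\<close>

section \<open>Gradients, Hessians and Taylor bounds\<close>

lemma GDERIV_gradient:
  fixes f :: "real^'n \<Rightarrow> real"
  assumes "f differentiable (at x)"
  shows "GDERIV f x :> gradient f x"
proof -
  obtain f' where f': "(f has_derivative f') (at x)"
    using assms by (auto simp: differentiable_def)
  define D where "D = (\<Sum>b\<in>Basis. f' b *\<^sub>R b)"
  have "f' h = h \<bullet> D" for h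
    unfolding D_def inner_sum_right inner_scaleR_right
    using Linear_Algebra.linear_componentwise[OF has_derivative_linear[OF f'], of h 1]
    by (simp add: mult.commute)
  then have "f' = (\<lambda>h. h \<bullet> D)" by (rule ext)
  with f' have D: "GDERIV f x :> D"
    by (simp add: gderiv_def)
  have "E = D" if "GDERIV f x :> E" for E
  proof -
    have "(\<lambda>h. h \<bullet> E) = (\<lambda>h. h \<bullet> D)"
      using that D has_derivative_unique unfolding gderiv_def by blast
    then have "\<forall>h. h \<bullet> E = h \<bullet> D" by meson
    then show ?thesis by (simp only: vector_eq_ldot)
  qed
  with D show ?thesis
    unfolding gradient_def by (rule theI)
qed

lemma gradient_along_line:
  fixes f :: "real^'n \<Rightarrow> real"
  assumes "f differentiable_on UNIV"
  shows "((\<lambda>s. f (y + s *\<^sub>R v)) has_real_derivative gradient f (y + s *\<^sub>R v) \<bullet> v) (at s)"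
proof -
  have "(f has_derivative (\<lambda>h. h \<bullet> gradient f (y + s *\<^sub>R v))) (at (y + s *\<^sub>R v))"
    using GDERIV_gradient[of f] assms
    by (simp add: gderiv_def differentiable_on_def)
  moreover have "((\<lambda>s. y + s *\<^sub>R v) has_derivative (\<lambda>h. h *\<^sub>R v)) (at s)"
    by (auto intro!: derivative_eq_intros)
  ultimately have "((\<lambda>s. f (y + s *\<^sub>R v)) has_derivative
      (\<lambda>h. (h *\<^sub>R v) \<bullet> gradient f (y + s *\<^sub>R v))) (at s)"
    by (rule has_derivative_compose[rotated])
  then show ?thesis
    by (simp add: has_field_derivative_def mult_commute_abs inner_commute)
qed

lemma hessian_has_derivative:
  fixes f :: "real^'n \<Rightarrow> real"
  assumes "gradient f differentiable_on UNIV"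
  shows "(gradient f has_derivative (\<lambda>h. hessian f x *v h)) (at x)"
  using assms unfolding differentiable_on_def hessian_def
  by (simp add: jacobian_works)

lemma hessian_along_line:
  fixes f :: "real^'n \<Rightarrow> real"
  assumes "gradient f differentiable_on UNIV"
  shows "((\<lambda>s. gradient f (y + s *\<^sub>R v) \<bullet> w) has_real_derivative
           (hessian f (y + s *\<^sub>R v) *v v) \<bullet> w) (at s)"
proof -
  have "((\<lambda>s. y + s *\<^sub>R v) has_derivative (\<lambda>h. h *\<^sub>R v)) (at s)"
    by (auto intro!: derivative_eq_intros)
  from has_derivative_compose[OF this hessian_has_derivative[OF assms]]
  have "((\<lambda>s. gradient f (y + s *\<^sub>R v)) has_derivative
      (\<lambda>h. hessian f (y + s *\<^sub>R v) *v (h *\<^sub>R v))) (at s)" .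
  from has_derivative_inner_left[OF this, of w] show ?thesis
    by (simp add: has_field_derivative_def mult_commute_abs matrix_vector_mult_scaleR)
qed

lemma le_if_derivative_le:
  fixes \<phi> \<psi> :: "real \<Rightarrow> real"
  assumes "\<And>s. (\<phi> has_real_derivative \<phi>' s) (at s)" and "\<And>s. (\<psi> has_real_derivative \<psi>' s) (at s)"
    and "\<And>s. 0 \<le> s \<Longrightarrow> \<phi>' s \<le> \<psi>' s" and "\<phi> 0 = \<psi> 0" and "0 \<le> t"
  shows "\<phi> t \<le> \<psi> t"
proof -
  have "\<phi> t - \<psi> t \<le> \<phi> 0 - \<psi> 0"
  proof (rule DERIV_nonpos_imp_nonincreasing[OF \<open>0 \<le> t\<close>])
    fix s :: real assume "0 \<le> s"
    then show "\<exists>d. ((\<lambda>s. \<phi> s - \<psi> s) has_real_derivative d) (at s) \<and> d \<le> 0"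
      using assms(3)[of s] by (intro exI[of _ "\<phi>' s - \<psi>' s"]) (auto intro!: DERIV_diff assms(1,2))
  qed
  with assms(4) show ?thesis by simp
qed

lemma descent_lemma:
  fixes f :: "real^'n \<Rightarrow> real"
  assumes f: "f differentiable_on UNIV" and L: "L-lipschitz_on UNIV (gradient f)"
  shows "f (y + v) \<le> f y + gradient f y \<bullet> v + L / 2 * (norm v)\<^sup>2"
proof -
  have "f (y + 1 *\<^sub>R v) \<le> f y + 1 * (gradient f y \<bullet> v) + L / 2 * 1\<^sup>2 * (norm v)\<^sup>2"
  proof (rule le_if_derivative_le[OF gradient_along_line[OF f], where
        \<psi> = "\<lambda>s. f y + s * (gradient f y \<bullet> v) + L / 2 * s\<^sup>2 * (norm v)\<^sup>2"])
    show "((\<lambda>s. f y + s * (gradient f y \<bullet> v) + L / 2 * s\<^sup>2 * (norm v)\<^sup>2)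
        has_real_derivative gradient f y \<bullet> v + L * s * (norm v)\<^sup>2) (at s)" for s
      by (auto intro!: derivative_eq_intros)
    fix s :: real assume "0 \<le> s"
    have "(gradient f (y + s *\<^sub>R v) - gradient f y) \<bullet> v
        \<le> norm (gradient f (y + s *\<^sub>R v) - gradient f y) * norm v"
      by (rule norm_cauchy_schwarz)
    also have "\<dots> \<le> (L * norm (s *\<^sub>R v)) * norm v"
      using lipschitz_onD[OF L, of "y + s *\<^sub>R v" y]
      by (intro mult_right_mono) (auto simp: dist_norm)
    finally show "gradient f (y + s *\<^sub>R v) \<bullet> v \<le> gradient f y \<bullet> v + L * s * (norm v)\<^sup>2"
      using \<open>0 \<le> s\<close> by (simp add: inner_diff_left power2_eq_square mult_ac)
  qed auto
  then show ?thesis by simp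
qed

text \<open>The descent lemma for one exact gradient step of length \<open>1 / L\<close>: the decrease that it
  guarantees cannot exceed the distance to the lower bound. In the method this bound makes the
  squared gradient integrable as soon as the function value is.\<close>

lemma gradient_norm_sq_le_gap:
  fixes f :: "real^'n \<Rightarrow> real"
  assumes f: "f differentiable_on UNIV" and L: "L-lipschitz_on UNIV (gradient f)" and "0 < L"
    and low: "\<And>z. fbar \<le> f z"
  shows "(norm (gradient f y))\<^sup>2 \<le> 2 * L * (f y - fbar)"
proof -
  have "fbar \<le> f (y + (- (1 / L)) *\<^sub>R gradient f y)" by (rule low)
  also have "\<dots> \<le> f y + gradient f y \<bullet> ((- (1 / L)) *\<^sub>R gradient f y)
      + L / 2 * (norm ((- (1 / L)) *\<^sub>R gradient f y))\<^sup>2"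
    by (rule descent_lemma[OF f L])
  also have "\<dots> = f y - (norm (gradient f y))\<^sup>2 / (2 * L)"
    using \<open>0 < L\<close>
    by (simp add: dot_square_norm power_mult_distrib power2_eq_square field_simps)
  finally show ?thesis using \<open>0 < L\<close> by (simp add: field_simps)
qed

text \<open>Integrating twice along the segment from \<open>y\<close> to \<open>y + v\<close>: the Lipschitz bound on the Hessian
  gives a quadratic error for the slope, and this gives a cubic error for the value.\<close>

lemma hessian_taylor_upper:
  fixes f :: "real^'n \<Rightarrow> real"
  assumes f: "twice_continuously_differentiable f" and L: "hessian_lipschitz L f"
  shows "f (y + v) \<le> f y + gradient f y \<bullet> v + (v \<bullet> (hessian f y *v v)) / 2 + L / 6 * norm v ^ 3"
proof -
  have f1: "f differentiable_on UNIV" and f2: "gradient f differentiable_on UNIV"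
    using f by (auto simp: twice_continuously_differentiable_def)
  have A: "(hessian f (y + s *\<^sub>R v) *v v) \<bullet> v \<le> (hessian f y *v v) \<bullet> v + L * s * norm v ^ 3"
    if "0 \<le> s" for s
  proof -
    have "((hessian f (y + s *\<^sub>R v) - hessian f y) *v v) \<bullet> v
        \<le> norm ((hessian f (y + s *\<^sub>R v) - hessian f y) *v v) * norm v"
      by (rule norm_cauchy_schwarz)
    also have "\<dots> \<le> (onorm (\<lambda>w. (hessian f (y + s *\<^sub>R v) - hessian f y) *v w) * norm v) * norm v"
      using onorm[OF matrix_vector_mul_bounded_linear, of "hessian f (y + s *\<^sub>R v) - hessian f y" v]
      by (intro mult_right_mono) simp_all
    also have "\<dots> \<le> ((L * norm (s *\<^sub>R v)) * norm v) * norm v"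
      using L[unfolded hessian_lipschitz_def, rule_format, of "y + s *\<^sub>R v" y]
      by (intro mult_right_mono) auto
    finally show ?thesis
      using \<open>0 \<le> s\<close>
      by (simp add: matrix_vector_mult_diff_rdistrib inner_diff_left power3_eq_cube mult_ac)
  qed
  have B: "gradient f (y + s *\<^sub>R v) \<bullet> v
      \<le> gradient f y \<bullet> v + s * ((hessian f y *v v) \<bullet> v) + L / 2 * s\<^sup>2 * norm v ^ 3"
    if "0 \<le> s" for s
  proof (rule le_if_derivative_le[OF hessian_along_line[OF f2], where
        \<psi> = "\<lambda>s. gradient f y \<bullet> v + s * ((hessian f y *v v) \<bullet> v) + L / 2 * s\<^sup>2 * norm v ^ 3"])
    show "((\<lambda>s. gradient f y \<bullet> v + s * ((hessian f y *v v) \<bullet> v) + L / 2 * s\<^sup>2 * norm v ^ 3)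
        has_real_derivative (hessian f y *v v) \<bullet> v + L * s * norm v ^ 3) (at s)" for s
      by (auto intro!: derivative_eq_intros)
  qed (use A that in auto)
  have "f (y + 1 *\<^sub>R v) \<le> f y + 1 * (gradient f y \<bullet> v) + 1\<^sup>2 / 2 * ((hessian f y *v v) \<bullet> v)
      + L / 6 * 1 ^ 3 * norm v ^ 3"
  proof (rule le_if_derivative_le[OF gradient_along_line[OF f1], where
        \<psi> = "\<lambda>s. f y + s * (gradient f y \<bullet> v) + s\<^sup>2 / 2 * ((hessian f y *v v) \<bullet> v)
              + L / 6 * s ^ 3 * norm v ^ 3"])
    show "((\<lambda>s. f y + s * (gradient f y \<bullet> v) + s\<^sup>2 / 2 * ((hessian f y *v v) \<bullet> v)
        + L / 6 * s ^ 3 * norm v ^ 3) has_real_derivative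
        gradient f y \<bullet> v + s * ((hessian f y *v v) \<bullet> v) + L / 2 * s\<^sup>2 * norm v ^ 3) (at s)" for s
      by (auto intro!: derivative_eq_intros)
  qed (use B in auto)
  then show ?thesis by (simp add: inner_commute)
qed

lemma gradient_linearization_error:
  fixes f :: "real^'n \<Rightarrow> real"
  assumes "gradient f differentiable_on UNIV" and "0 < e"
  obtains d where "0 < d"
    and "\<And>h. norm h < d \<Longrightarrow> norm (gradient f (x + h) - gradient f x - hessian f x *v h) \<le> e * norm h"
proof -
  obtain d where "0 < d" and d: "\<And>y. norm (y - x) < d \<Longrightarrow>
      norm (gradient f y - gradient f x - hessian f x *v (y - x)) \<le> e * norm (y - x)"
    using hessian_has_derivative[OF assms(1), of x] \<open>0 < e\<close> unfolding has_derivative_at_alt by blast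
  show ?thesis
    using d[of "x + h" for h] by (intro that[OF \<open>0 < d\<close>]) simp
qed

lemma hessian_norm_le:
  fixes f :: "real^'n \<Rightarrow> real"
  assumes f: "gradient f differentiable_on UNIV" and L: "L-lipschitz_on UNIV (gradient f)"
  shows "norm (hessian f x *v v) \<le> L * norm v"
proof (cases "v = 0")
  case False
  have "norm (hessian f x *v v) / norm v \<le> L + e" if "0 < e" for e
  proof -
    obtain d where "0 < d" and d: "\<And>h. norm h < d \<Longrightarrow>
        norm (gradient f (x + h) - gradient f x - hessian f x *v h) \<le> e * norm h"
      using gradient_linearization_error[OF f \<open>0 < e\<close>] by metis
    define s where "s = d / (2 * norm v)"
    have s: "0 < s" "norm (s *\<^sub>R v) < d"
      using \<open>0 < d\<close> False by (auto simp: s_def)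
    have "s * norm (hessian f x *v v) = norm (hessian f x *v (s *\<^sub>R v))"
      using s by (simp add: matrix_vector_mult_scaleR)
    also have "\<dots> \<le> norm (gradient f (x + s *\<^sub>R v) - gradient f x)
        + norm (gradient f (x + s *\<^sub>R v) - gradient f x - hessian f x *v (s *\<^sub>R v))"
      by norm
    also have "\<dots> \<le> L * norm (s *\<^sub>R v) + e * norm (s *\<^sub>R v)"
      using lipschitz_onD[OF L, of "x + s *\<^sub>R v" x] d[OF s(2)] by (simp add: dist_norm)
    also have "\<dots> = s * ((L + e) * norm v)" using s by (simp add: algebra_simps)
    finally have "norm (hessian f x *v v) \<le> (L + e) * norm v" using s by simp
    then show ?thesis using False by (simp add: field_simps)
  qed
  then have "norm (hessian f x *v v) / norm v \<le> L" by (rule field_le_epsilon)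
  then show ?thesis using False by (simp add: field_simps)
qed simp

text \<open>The mean value theorem turns the second difference of \<open>f\<close> into a difference of gradients at two
  points near \<open>x\<close>, and differentiability of the gradient at \<open>x\<close> evaluates that difference up to
  \<open>e\<close> times the step.\<close>

lemma second_difference:
  fixes f :: "real^'n \<Rightarrow> real"
  assumes f1: "f differentiable_on UNIV"
    and d: "\<And>h. norm h < d \<Longrightarrow> norm (gradient f (x + h) - gradient f x - hessian f x *v h) \<le> e * norm h"
    and "0 \<le> e" and "0 < s" and s: "s * (norm u + norm v) < d"
  shows "\<bar>f (x + s *\<^sub>R u + s *\<^sub>R v) - f (x + s *\<^sub>R u) - f (x + s *\<^sub>R v) + f x
          - s\<^sup>2 * (v \<bullet> (hessian f x *v u))\<bar> \<le> s\<^sup>2 * (e * (norm u + 2 * norm v) * norm v)"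
proof -
  let ?G = "gradient f" and ?A = "hessian f x"
  define \<phi> where "\<phi> = (\<lambda>\<tau>. f (x + s *\<^sub>R u + \<tau> *\<^sub>R v) - f (x + \<tau> *\<^sub>R v))"
  have "\<exists>\<xi>>0. \<xi> < s \<and> \<phi> s - \<phi> 0 =
      (s - 0) * (?G (x + s *\<^sub>R u + \<xi> *\<^sub>R v) \<bullet> v - ?G (x + \<xi> *\<^sub>R v) \<bullet> v)"
    unfolding \<phi>_def using \<open>0 < s\<close> by (intro MVT2 DERIV_diff gradient_along_line f1)
  then obtain \<xi> where \<xi>: "0 < \<xi>" "\<xi> < s" and
    eq: "\<phi> s - \<phi> 0 = s * ((?G (x + s *\<^sub>R u + \<xi> *\<^sub>R v) - ?G (x + \<xi> *\<^sub>R v)) \<bullet> v)"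
    by (auto simp: inner_diff_left)
  define r where "r = (\<lambda>h. ?G (x + h) - ?G x - ?A *v h)"
  have "norm (\<xi> *\<^sub>R v) \<le> s * norm v"
    using \<xi> by (simp add: mult_right_mono)
  then have n1: "norm (s *\<^sub>R u + \<xi> *\<^sub>R v) \<le> s * (norm u + norm v)" and n2: "norm (\<xi> *\<^sub>R v) \<le> s * norm v"
    using \<open>0 < s\<close> norm_triangle_ineq[of "s *\<^sub>R u" "\<xi> *\<^sub>R v"] by (auto simp: distrib_left)
  have "s * norm v \<le> s * (norm u + norm v)" using \<open>0 < s\<close> by simp
  then have r1: "norm (r (s *\<^sub>R u + \<xi> *\<^sub>R v)) \<le> e * (s * (norm u + norm v))"
    and r2: "norm (r (\<xi> *\<^sub>R v)) \<le> e * (s * norm v)"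
    using d[of "s *\<^sub>R u + \<xi> *\<^sub>R v"] d[of "\<xi> *\<^sub>R v"] n1 n2 s \<open>0 \<le> e\<close>
      mult_left_mono[OF n1 \<open>0 \<le> e\<close>] mult_left_mono[OF n2 \<open>0 \<le> e\<close>]
    unfolding r_def by linarith+
  have "?G (x + s *\<^sub>R u + \<xi> *\<^sub>R v) - ?G (x + \<xi> *\<^sub>R v)
      = s *\<^sub>R (?A *v u) + (r (s *\<^sub>R u + \<xi> *\<^sub>R v) - r (\<xi> *\<^sub>R v))"
    unfolding r_def by (simp add: matrix_vector_right_distrib matrix_vector_mult_scaleR add.assoc)
  then have "(?G (x + s *\<^sub>R u + \<xi> *\<^sub>R v) - ?G (x + \<xi> *\<^sub>R v)) \<bullet> v
      = s * (v \<bullet> (?A *v u)) + (r (s *\<^sub>R u + \<xi> *\<^sub>R v) - r (\<xi> *\<^sub>R v)) \<bullet> v"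
    by (simp add: inner_add_left inner_add_right inner_commute)
  then have "\<phi> s - \<phi> 0 - s\<^sup>2 * (v \<bullet> (?A *v u)) = s * ((r (s *\<^sub>R u + \<xi> *\<^sub>R v) - r (\<xi> *\<^sub>R v)) \<bullet> v)"
    unfolding eq by (simp only: power2_eq_square distrib_left mult.assoc)
  also have "\<bar>\<dots>\<bar> \<le> s * (norm (r (s *\<^sub>R u + \<xi> *\<^sub>R v) - r (\<xi> *\<^sub>R v)) * norm v)"
    using \<open>0 < s\<close> Cauchy_Schwarz_ineq2 by (simp add: abs_mult)
  also have "\<dots> \<le> s * ((e * (s * (norm u + norm v)) + e * (s * norm v)) * norm v)"
    using \<open>0 < s\<close> r1 r2 norm_triangle_ineq4[of "r (s *\<^sub>R u + \<xi> *\<^sub>R v)" "r (\<xi> *\<^sub>R v)"]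
    by (intro mult_left_mono mult_right_mono) auto
  finally show ?thesis
    unfolding \<phi>_def by (simp add: algebra_simps power2_eq_square)
qed

text \<open>The second difference is symmetric in \<open>u\<close> and \<open>v\<close>, whereas each of its two evaluations by the
  Hessian has a relative error that is as small as desired.\<close>

lemma hessian_symmetric:
  fixes f :: "real^'n \<Rightarrow> real"
  assumes f1: "f differentiable_on UNIV" and f2: "gradient f differentiable_on UNIV"
  shows "u \<bullet> (hessian f x *v v) = (hessian f x *v u) \<bullet> v"
proof -
  define K where "K = (norm u + 2 * norm v) * norm v + (norm v + 2 * norm u) * norm u"
  define a where "a = \<bar>v \<bullet> (hessian f x *v u) - u \<bullet> (hessian f x *v v)\<bar>"
  have "a \<le> e * K" if "0 < e" for e
  proof -
    obtain d where "0 < d" and d: "\<And>h. norm h < d \<Longrightarrow>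
        norm (gradient f (x + h) - gradient f x - hessian f x *v h) \<le> e * norm h"
      using gradient_linearization_error[OF f2 \<open>0 < e\<close>] by metis
    define s where "s = d / (norm u + norm v + 1)"
    have s: "0 < s" "s * (norm u + norm v) < d"
      using \<open>0 < d\<close> by (auto simp: s_def field_simps add_pos_nonneg add_nonneg_pos)
    let ?D = "f (x + s *\<^sub>R u + s *\<^sub>R v) - f (x + s *\<^sub>R u) - f (x + s *\<^sub>R v) + f x"
    have "\<bar>?D - s\<^sup>2 * (v \<bullet> (hessian f x *v u))\<bar> \<le> s\<^sup>2 * (e * (norm u + 2 * norm v) * norm v)"
      using second_difference[OF f1 d _ s] \<open>0 < e\<close> by simp
    moreover have "\<bar>?D - s\<^sup>2 * (u \<bullet> (hessian f x *v v))\<bar> \<le> s\<^sup>2 * (e * (norm v + 2 * norm u) * norm u)"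
      using second_difference[OF f1 d _ s(1), where u = v and v = u] \<open>0 < e\<close> s(2) by (simp add: algebra_simps)
    ultimately have "\<bar>s\<^sup>2 * (v \<bullet> (hessian f x *v u)) - s\<^sup>2 * (u \<bullet> (hessian f x *v v))\<bar>
        \<le> s\<^sup>2 * (e * (norm u + 2 * norm v) * norm v) + s\<^sup>2 * (e * (norm v + 2 * norm u) * norm u)"
      by linarith
    also have "\<dots> = s\<^sup>2 * (e * K)" by (simp add: K_def algebra_simps)
    finally have "s\<^sup>2 * a \<le> s\<^sup>2 * (e * K)"
      unfolding a_def by (simp add: abs_mult flip: right_diff_distrib)
    then show ?thesis using s by simp
  qed
  note le = this
  have "0 \<le> K" by (simp add: K_def)
  have "a \<le> 0"
  proof (rule field_le_epsilon)
    fix e :: real assume "0 < e"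
    have "a \<le> e / (K + 1) * K" using le[of "e / (K + 1)"] \<open>0 \<le> K\<close> \<open>0 < e\<close> by simp
    also have "\<dots> \<le> e" using \<open>0 \<le> K\<close> \<open>0 < e\<close> by (simp add: field_simps)
    finally show "a \<le> 0 + e" by simp
  qed
  then show ?thesis by (simp add: a_def inner_commute)
qed


section \<open>The left-most eigenvalue of a symmetric matrix\<close>

text \<open>Eigenvectors for distinct eigenvalues are orthogonal, hence linearly independent. Finiteness is
  what gives the minimum in the definition of \<open>lambda_min\<close> its meaning.\<close>

lemma finite_eigenvalues_symmetric:
  fixes A :: "real^'n^'n"
  assumes sym: "\<And>u v. u \<bullet> (A *v v) = (A *v u) \<bullet> v"
  shows "finite {l. \<exists>v. v \<noteq> 0 \<and> A *v v = l *\<^sub>R v}"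
proof -
  let ?E = "{l. \<exists>v. v \<noteq> 0 \<and> A *v v = l *\<^sub>R v}"
  define V where "V = (\<lambda>l. SOME v. v \<noteq> 0 \<and> A *v v = l *\<^sub>R v)"
  have V: "V l \<noteq> 0 \<and> A *v V l = l *\<^sub>R V l" if "l \<in> ?E" for l
    unfolding V_def by (rule someI_ex) (use that in auto)
  have orth: "V k \<bullet> V l = 0" if "k \<in> ?E" "l \<in> ?E" "k \<noteq> l" for k l
    using sym[of "V k" "V l"] V[OF that(1)] V[OF that(2)] that(3) by simp
  have inj: "inj_on V ?E"
    using orth V by (force intro!: inj_onI)
  have "pairwise orthogonal (V ` ?E)"
    using orth by (auto simp: pairwise_def orthogonal_def)
  moreover have "0 \<notin> V ` ?E" using V by force
  ultimately have "finite (V ` ?E)"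
    using pairwise_orthogonal_independent independent_imp_finite by blast
  then show ?thesis using inj by (rule finite_imageD)
qed

text \<open>A minimizer of the quadratic form on the unit sphere exists by compactness, and first-order
  optimality makes it an eigenvector.\<close>

lemma symmetric_rayleigh_minimizer:
  fixes A :: "real^'n^'n"
  assumes sym: "\<And>u v. u \<bullet> (A *v v) = (A *v u) \<bullet> v"
  obtains v \<mu> where "norm v = 1" and "A *v v = \<mu> *\<^sub>R v" and "\<And>w. \<mu> * (norm w)\<^sup>2 \<le> w \<bullet> (A *v w)"
proof -
  let ?Q = "\<lambda>v. v \<bullet> (A *v v)"
  have "continuous_on (sphere 0 1) ?Q"
    by (intro continuous_intros linear_continuous_on matrix_vector_mul_bounded_linear)
  moreover have "(axis undefined 1 :: real^'n) \<in> sphere 0 1" by simp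
  ultimately obtain v where v: "v \<in> sphere 0 1" and min: "\<And>w. w \<in> sphere 0 1 \<Longrightarrow> ?Q v \<le> ?Q w"
    using continuous_attains_inf[OF compact_sphere, of "0::real^'n" 1 ?Q] by auto
  define \<mu> where "\<mu> = ?Q v"
  have ray: "\<mu> * (norm w)\<^sup>2 \<le> ?Q w" for w
  proof (cases "w = 0")
    case False
    have "\<mu> \<le> ?Q ((1 / norm w) *\<^sub>R w)"
      unfolding \<mu>_def using False by (intro min) simp
    also have "\<dots> = ?Q w / (norm w)\<^sup>2"
      by (simp add: matrix_vector_mult_scaleR power2_eq_square)
    finally show ?thesis using False by (simp add: field_simps)
  qed simp
  have "A *v v - \<mu> *\<^sub>R v = 0"
  proof -
    define w where "w = A *v v - \<mu> *\<^sub>R v"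
    define c where "c = ?Q w - \<mu> * (norm w)\<^sup>2"
    have nv: "v \<bullet> v = 1" using v by (simp add: norm_eq_1)
    \<comment> \<open>First-order optimality of \<open>v\<close> along the line \<open>v + t w\<close>.\<close>
    have *: "0 \<le> 2 * t * (w \<bullet> w) + t\<^sup>2 * c" for t
    proof -
      have "w \<bullet> (A *v v) = v \<bullet> (A *v w)"
        by (subst sym) (simp add: inner_commute)
      then have "?Q (v + t *\<^sub>R w) = \<mu> + 2 * t * (w \<bullet> (A *v v)) + t\<^sup>2 * ?Q w"
        by (simp add: \<mu>_def matrix_vector_right_distrib matrix_vector_mult_scaleR inner_add_left
            inner_add_right power2_eq_square algebra_simps)
      moreover have "(norm (v + t *\<^sub>R w))\<^sup>2 = 1 + 2 * t * (w \<bullet> v) + t\<^sup>2 * (norm w)\<^sup>2"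
        unfolding power2_norm_eq_inner using nv
        by (simp add: inner_add_left inner_add_right inner_commute power2_eq_square algebra_simps)
      moreover have "w \<bullet> (A *v v) = w \<bullet> w + \<mu> * (w \<bullet> v)"
        by (simp add: w_def inner_diff_left inner_diff_right algebra_simps)
      ultimately show ?thesis
        using ray[of "v + t *\<^sub>R w"] by (simp add: c_def algebra_simps)
    qed
    have "w \<bullet> w = 0"
    proof (rule ccontr)
      assume "w \<bullet> w \<noteq> 0"
      then have pos: "0 < w \<bullet> w" by simp
      have "0 \<le> c" by (simp add: c_def ray)
      define k where "k = c + 1"
      have k: "k \<noteq> 0" "c = k - 1" using \<open>0 \<le> c\<close> by (auto simp: k_def)
      \<comment> \<open>The minimizer of the quadratic would have denominator \<open>c\<close>, which may be 0.\<close>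
      define t where "t = - (w \<bullet> w) / k"
      have "2 * t * (w \<bullet> w) + t\<^sup>2 * c = (w \<bullet> w)\<^sup>2 / k\<^sup>2 * (c - 2 * k)"
        using k(1) unfolding t_def k(2) by (simp add: field_simps power2_eq_square)
      also have "\<dots> < 0"
        using pos \<open>0 \<le> c\<close> k by (intro mult_pos_neg) auto
      finally show False using *[of t] by simp
    qed
    then show ?thesis by (simp add: w_def)
  qed
  then show ?thesis using v ray by (intro that[of v \<mu>]) auto
qed

lemma lambda_min_rayleigh:
  fixes A :: "real^'n^'n"
  assumes sym: "\<And>u v. u \<bullet> (A *v v) = (A *v u) \<bullet> v"
  shows "lambda_min A * (norm w)\<^sup>2 \<le> w \<bullet> (A *v w)"
    and "\<exists>v. norm v = 1 \<and> v \<bullet> (A *v v) = lambda_min A"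
proof -
  obtain v \<mu> where v: "norm v = 1" "A *v v = \<mu> *\<^sub>R v" and ray: "\<And>w. \<mu> * (norm w)\<^sup>2 \<le> w \<bullet> (A *v w)"
    using symmetric_rayleigh_minimizer[OF sym] by metis
  have "lambda_min A = \<mu>"
    unfolding lambda_min_def
  proof (rule Min_eqI)
    show "finite {l. \<exists>v. v \<noteq> 0 \<and> A *v v = l *\<^sub>R v}"
      by (rule finite_eigenvalues_symmetric[OF sym])
    show "\<mu> \<in> {l. \<exists>v. v \<noteq> 0 \<and> A *v v = l *\<^sub>R v}"
      using v by (auto intro!: exI[of _ v])
    fix l assume "l \<in> {l. \<exists>v. v \<noteq> 0 \<and> A *v v = l *\<^sub>R v}"
    then obtain w where "w \<noteq> 0" "A *v w = l *\<^sub>R w" by auto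
    then show "\<mu> \<le> l" using ray[of w] by (simp add: dot_square_norm)
  qed
  moreover have "v \<bullet> (A *v v) = \<mu>" using v by (simp add: dot_square_norm)
  ultimately show "lambda_min A * (norm w)\<^sup>2 \<le> w \<bullet> (A *v w)"
    and "\<exists>v. norm v = 1 \<and> v \<bullet> (A *v v) = lambda_min A"
    using ray v by auto
qed

text \<open>Test the Rayleigh quotient of \<open>A\<close> with a minimizing vector for \<open>B\<close>.\<close>

lemma lambda_min_diff_le_onorm:
  fixes A B :: "real^'n^'n"
  assumes A: "\<And>u v. u \<bullet> (A *v v) = (A *v u) \<bullet> v" and B: "\<And>u v. u \<bullet> (B *v v) = (B *v u) \<bullet> v"
  shows "lambda_min A - lambda_min B \<le> onorm (\<lambda>v. (A - B) *v v)"
proof -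
  obtain v where v: "norm v = 1" "v \<bullet> (B *v v) = lambda_min B"
    using lambda_min_rayleigh(2)[OF B] by blast
  have "lambda_min A \<le> v \<bullet> (A *v v)"
    using lambda_min_rayleigh(1)[OF A, of v] v by simp
  then have "lambda_min A - lambda_min B \<le> v \<bullet> ((A - B) *v v)"
    using v by (simp add: matrix_vector_mult_diff_rdistrib inner_diff_right)
  also have "\<dots> \<le> norm v * norm ((A - B) *v v)" by (rule norm_cauchy_schwarz)
  also have "\<dots> \<le> onorm (\<lambda>v. (A - B) *v v)"
    using onorm[OF matrix_vector_mul_bounded_linear, of "A - B" v] v by simp
  finally show ?thesis .
qed

text \<open>The left-most eigenvalue inherits the Lipschitz constant of the Hessian. Through this continuity
  the curvature at an iterate is a random variable measurable with respect to the past.\<close>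

lemma lambda_min_hessian_lipschitz:
  fixes f :: "real^'n \<Rightarrow> real"
  assumes f: "twice_continuously_differentiable f" and L: "hessian_lipschitz L f" and "0 \<le> L"
  shows "L-lipschitz_on UNIV (\<lambda>x. lambda_min (hessian f x))"
proof (rule lipschitz_onI)
  fix x y :: "real^'n"
  have sym: "u \<bullet> (hessian f z *v v) = (hessian f z *v u) \<bullet> v" for z u v
    using f hessian_symmetric unfolding twice_continuously_differentiable_def by blast
  have "lambda_min (hessian f x) - lambda_min (hessian f y) \<le> L * norm (x - y)" for x y
    using lambda_min_diff_le_onorm[of "hessian f x" "hessian f y", OF sym sym] L
    unfolding hessian_lipschitz_def by (meson order_trans)
  from this[of x y] this[of y x]
  show "dist (lambda_min (hessian f x)) (lambda_min (hessian f y)) \<le> L * dist x y"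
    by (simp add: dist_norm norm_minus_commute)
qed (use assms in auto)

lemma abs_lambda_min_hessian_le:
  fixes f :: "real^'n \<Rightarrow> real"
  assumes f: "twice_continuously_differentiable f" and L: "L-lipschitz_on UNIV (gradient f)"
  shows "\<bar>lambda_min (hessian f x)\<bar> \<le> L"
proof -
  have f1: "f differentiable_on UNIV" and f2: "gradient f differentiable_on UNIV"
    using f by (auto simp: twice_continuously_differentiable_def)
  obtain v where v: "norm v = 1" "v \<bullet> (hessian f x *v v) = lambda_min (hessian f x)"
    using lambda_min_rayleigh(2)[OF hessian_symmetric[OF f1 f2]] by blast
  then have "\<bar>lambda_min (hessian f x)\<bar> \<le> norm v * norm (hessian f x *v v)"
    using Cauchy_Schwarz_ineq2[of v "hessian f x *v v"] by simp
  then show ?thesis using hessian_norm_le[OF f2 L, of x v] v by simp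
qed

section \<open>Conditional moment inequalities\<close>

lemma subalgebra_sigma_of:
  assumes "\<And>X. X \<in> S \<Longrightarrow> X \<in> borel_measurable M"
  shows "subalgebra M (sigma_of M S)"
proof -
  have sub: "{X -` A \<inter> space M | X A. X \<in> S \<and> A \<in> sets borel} \<subseteq> sets M"
    using assms by (auto intro: measurable_sets)
  then have "{X -` A \<inter> space M | X A. X \<in> S \<and> A \<in> sets borel} \<subseteq> Pow (space M)"
    using sets.sets_into_space by blast
  then show ?thesis
    unfolding subalgebra_def sigma_of_def
    using sets.sigma_sets_subset[OF sub] by (simp add: space_measure_of_conv)
qed

lemma measurable_sigma_of:
  assumes "X \<in> S"
  shows "X \<in> borel_measurable (sigma_of M S)"
proof (rule measurableI)
  fix A :: "'b set" assume "A \<in> sets borel"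
  then show "X -` A \<inter> space (sigma_of M S) \<in> sets (sigma_of M S)"
    unfolding sigma_of_def using assms
    by (subst sets_measure_of; (auto simp: space_measure_of_conv)?)
qed simp

text \<open>Conditional inequalities are only ever used after integration against a weight known to the
  conditioning \<open>\<sigma>\<close>-algebra; this lemma and the next convert them into that form.\<close>

lemma (in sigma_finite_subalgebra) nn_integral_le_if_nn_cond_exp_le:
  fixes w c X Y :: "'a \<Rightarrow> ennreal"
  assumes [measurable]: "w \<in> borel_measurable F" "c \<in> borel_measurable F"
    "X \<in> borel_measurable M" "Y \<in> borel_measurable M"
    and le: "AE \<omega> in M. nn_cond_exp M F X \<omega> \<le> c \<omega> * nn_cond_exp M F Y \<omega>"
  shows "(\<integral>\<^sup>+\<omega>. w \<omega> * X \<omega> \<partial>M) \<le> (\<integral>\<^sup>+\<omega>. w \<omega> * c \<omega> * Y \<omega> \<partial>M)"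
proof -
  have "(\<integral>\<^sup>+\<omega>. w \<omega> * X \<omega> \<partial>M) = (\<integral>\<^sup>+\<omega>. w \<omega> * nn_cond_exp M F X \<omega> \<partial>M)"
    by (rule nn_cond_exp_intg[symmetric]) auto
  also have "\<dots> \<le> (\<integral>\<^sup>+\<omega>. w \<omega> * c \<omega> * nn_cond_exp M F Y \<omega> \<partial>M)"
    using le by (intro nn_integral_mono_AE) (auto simp: mult.assoc intro!: mult_left_mono)
  also have "\<dots> = (\<integral>\<^sup>+\<omega>. w \<omega> * c \<omega> * Y \<omega> \<partial>M)"
    by (rule nn_cond_exp_intg) auto
  finally show ?thesis .
qed

lemma (in sigma_finite_subalgebra) nn_integral_le_if_nn_cond_exp_le_const:
  fixes w c X :: "'a \<Rightarrow> ennreal"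
  assumes [measurable]: "w \<in> borel_measurable F" "X \<in> borel_measurable M"
    and le: "AE \<omega> in M. nn_cond_exp M F X \<omega> \<le> c \<omega>"
  shows "(\<integral>\<^sup>+\<omega>. w \<omega> * X \<omega> \<partial>M) \<le> (\<integral>\<^sup>+\<omega>. w \<omega> * c \<omega> \<partial>M)"
proof -
  have "(\<integral>\<^sup>+\<omega>. w \<omega> * X \<omega> \<partial>M) = (\<integral>\<^sup>+\<omega>. w \<omega> * nn_cond_exp M F X \<omega> \<partial>M)"
    by (rule nn_cond_exp_intg[symmetric]) auto
  also have "\<dots> \<le> (\<integral>\<^sup>+\<omega>. w \<omega> * c \<omega> \<partial>M)"
    using le by (intro nn_integral_mono_AE) (auto intro!: mult_left_mono)
  finally show ?thesis .
qed

lemma integrable_if_nn_integral_le: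
  fixes X Y :: "'a \<Rightarrow> real"
  assumes [measurable]: "X \<in> borel_measurable M" and X: "\<And>\<omega>. \<omega> \<in> space M \<Longrightarrow> 0 \<le> X \<omega>"
    and Y: "integrable M Y" "\<And>\<omega>. \<omega> \<in> space M \<Longrightarrow> 0 \<le> Y \<omega>"
    and le: "(\<integral>\<^sup>+\<omega>. ennreal (X \<omega>) \<partial>M) \<le> (\<integral>\<^sup>+\<omega>. ennreal (Y \<omega>) \<partial>M)"
  shows "integrable M X" and "(\<integral>\<omega>. X \<omega> \<partial>M) \<le> (\<integral>\<omega>. Y \<omega> \<partial>M)"
proof -
  have Yeq: "(\<integral>\<^sup>+\<omega>. ennreal (Y \<omega>) \<partial>M) = ennreal (\<integral>\<omega>. Y \<omega> \<partial>M)"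
    using Y by (intro nn_integral_eq_integral AE_I2)
  have XeqN: "(\<integral>\<^sup>+\<omega>. ennreal (norm (X \<omega>)) \<partial>M) = (\<integral>\<^sup>+\<omega>. ennreal (X \<omega>) \<partial>M)"
    using X by (intro nn_integral_cong) auto
  show int: "integrable M X"
    unfolding integrable_iff_bounded XeqN
    using le Yeq by (simp add: le_less_trans[OF _ ennreal_less_top])
  have "(\<integral>\<^sup>+\<omega>. ennreal (X \<omega>) \<partial>M) = ennreal (\<integral>\<omega>. X \<omega> \<partial>M)"
    using X int by (intro nn_integral_eq_integral AE_I2)
  then show "(\<integral>\<omega>. X \<omega> \<partial>M) \<le> (\<integral>\<omega>. Y \<omega> \<partial>M)"
    using le Yeq Y by (simp add: integral_nonneg_AE)
qed

lemma integrable_if_sandwiched: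
  fixes X Y :: "'a \<Rightarrow> real"
  assumes "X \<in> borel_measurable M" and "integrable M Y" and "integrable M Z"
    and "\<And>\<omega>. \<omega> \<in> space M \<Longrightarrow> Z \<omega> \<le> X \<omega>" and "\<And>\<omega>. \<omega> \<in> space M \<Longrightarrow> X \<omega> \<le> Y \<omega>"
  shows "integrable M X"
proof (rule Bochner_Integration.integrable_bound)
  show "integrable M (\<lambda>\<omega>. \<bar>Y \<omega>\<bar> + \<bar>Z \<omega>\<bar>)" using assms by auto
  show "AE \<omega> in M. norm (X \<omega>) \<le> norm (\<bar>Y \<omega>\<bar> + \<bar>Z \<omega>\<bar>)"
    using assms(4,5) by (intro AE_I2) force
qed (use assms in auto)

lemma (in finite_measure) integrable_lower_power:
  fixes X :: "'a \<Rightarrow> real"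
  assumes [measurable]: "X \<in> borel_measurable M" and X: "\<And>\<omega>. \<omega> \<in> space M \<Longrightarrow> 0 \<le> X \<omega>"
    and int: "integrable M (\<lambda>\<omega>. X \<omega> ^ n)" and "i \<le> n"
  shows "integrable M (\<lambda>\<omega>. X \<omega> ^ i)"
proof (rule integrable_if_sandwiched[where Z = "\<lambda>_. 0" and Y = "\<lambda>\<omega>. 1 + X \<omega> ^ n"])
  fix \<omega> assume "\<omega> \<in> space M"
  note X = X[OF this]
  show "X \<omega> ^ i \<le> 1 + X \<omega> ^ n"
  proof (cases "X \<omega> \<le> 1")
    case True
    then have "X \<omega> ^ i \<le> 1" using X by (simp add: power_le_one)
    moreover have "0 \<le> X \<omega> ^ n" using X by simp
    ultimately show ?thesis by linarith
  next
    case False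
    then have "X \<omega> ^ i \<le> X \<omega> ^ n" using \<open>i \<le> n\<close> by (intro power_increasing) auto
    then show ?thesis by linarith
  qed
qed (use int X in auto)

lemma integrable_bounded_mult:
  fixes X Y :: "'a \<Rightarrow> real"
  assumes "integrable M Y" and "X \<in> borel_measurable M"
    and "\<And>\<omega>. \<omega> \<in> space M \<Longrightarrow> 0 \<le> X \<omega>" and "\<And>\<omega>. \<omega> \<in> space M \<Longrightarrow> X \<omega> \<le> B"
  shows "integrable M (\<lambda>\<omega>. X \<omega> * Y \<omega>)"
proof (rule Bochner_Integration.integrable_bound)
  show "integrable M (\<lambda>\<omega>. B * Y \<omega>)" using assms by auto
  show "AE \<omega> in M. norm (X \<omega> * Y \<omega>) \<le> norm (B * Y \<omega>)"
  proof (rule AE_I2)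
    fix \<omega> assume "\<omega> \<in> space M"
    with assms(3,4) have "\<bar>X \<omega>\<bar> \<le> \<bar>B\<bar>" by force
    then show "norm (X \<omega> * Y \<omega>) \<le> norm (B * Y \<omega>)"
      by (simp add: abs_mult mult_right_mono)
  qed
qed (use assms in auto)

text \<open>For \<open>b > 0\<close> known to the conditioning \<open>\<sigma>\<close>-algebra, \<open>2 U V \<le> b U\<^sup>2 + V\<^sup>2 / b\<close>. With \<open>b = a\<close> the
  hypothesis makes both terms on the right equally large in conditional mean. Since \<open>a\<close> may vanish,
  take \<open>b = a + \<eta>\<close> and let \<open>\<eta>\<close> tend to 0.\<close>

lemma (in finite_measure_subalgebra) conditional_cauchy_schwarz:
  fixes U V a :: "'a \<Rightarrow> real"
  assumes [measurable]: "U \<in> borel_measurable M" "V \<in> borel_measurable M"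
    and a[measurable]: "a \<in> borel_measurable F" and a0: "\<And>\<omega>. 0 \<le> a \<omega>" and aB: "\<And>\<omega>. a \<omega> \<le> B"
    and U2: "integrable M (\<lambda>\<omega>. (U \<omega>)\<^sup>2)"
    and le: "AE \<omega> in M. nn_cond_exp M F (\<lambda>\<omega>. ennreal ((V \<omega>)\<^sup>2)) \<omega>
        \<le> ennreal ((a \<omega>)\<^sup>2) * nn_cond_exp M F (\<lambda>\<omega>. ennreal ((U \<omega>)\<^sup>2)) \<omega>"
  shows "integrable M (\<lambda>\<omega>. U \<omega> * V \<omega>)"
    and "(\<integral>\<omega>. U \<omega> * V \<omega> \<partial>M) \<le> (\<integral>\<omega>. a \<omega> * (U \<omega>)\<^sup>2 \<partial>M)"
proof -
  have aM[measurable]: "a \<in> borel_measurable M" by (rule measurable_from_subalg[OF subalg a])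
  have wt: "(\<integral>\<^sup>+\<omega>. ennreal (w \<omega> * (V \<omega>)\<^sup>2) \<partial>M) \<le> (\<integral>\<^sup>+\<omega>. ennreal (w \<omega> * (a \<omega>)\<^sup>2 * (U \<omega>)\<^sup>2) \<partial>M)"
    if [measurable]: "w \<in> borel_measurable F" and w: "\<And>\<omega>. 0 \<le> w \<omega>" for w
    using nn_integral_le_if_nn_cond_exp_le[where w = "\<lambda>\<omega>. ennreal (w \<omega>)" and c = "\<lambda>\<omega>. ennreal ((a \<omega>)\<^sup>2)"
        and X = "\<lambda>\<omega>. ennreal ((V \<omega>)\<^sup>2)" and Y = "\<lambda>\<omega>. ennreal ((U \<omega>)\<^sup>2)"] le w
    by (simp add: ennreal_mult)
  have a2U2: "integrable M (\<lambda>\<omega>. (a \<omega>)\<^sup>2 * (U \<omega>)\<^sup>2)"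
    by (rule integrable_bounded_mult[OF U2, where B = "B\<^sup>2"]) (auto intro: power_mono a0 aB)
  have V2: "integrable M (\<lambda>\<omega>. (V \<omega>)\<^sup>2)"
    by (rule integrable_if_nn_integral_le(1)[OF _ _ a2U2]) (use wt[of "\<lambda>_. 1"] in auto)
  have aU2: "integrable M (\<lambda>\<omega>. a \<omega> * (U \<omega>)\<^sup>2)"
    by (rule integrable_bounded_mult[OF U2 aM a0 aB])
  have amgm: "\<bar>U \<omega> * V \<omega>\<bar> \<le> ((U \<omega>)\<^sup>2 + (V \<omega>)\<^sup>2) / 2" for \<omega>
    using sum_squares_bound[of "\<bar>U \<omega>\<bar>" "\<bar>V \<omega>\<bar>"] by (simp add: abs_mult)
  show int: "integrable M (\<lambda>\<omega>. U \<omega> * V \<omega>)"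
    by (rule Bochner_Integration.integrable_bound[of _ "\<lambda>\<omega>. ((U \<omega>)\<^sup>2 + (V \<omega>)\<^sup>2) / 2"])
      (use U2 V2 amgm in auto)
  show "(\<integral>\<omega>. U \<omega> * V \<omega> \<partial>M) \<le> (\<integral>\<omega>. a \<omega> * (U \<omega>)\<^sup>2 \<partial>M)"
  proof (rule field_le_epsilon)
    fix e :: real assume "0 < e"
    define I where "I = (\<integral>\<omega>. (U \<omega>)\<^sup>2 \<partial>M)"
    have "0 \<le> I" by (simp add: I_def)
    define \<eta> where "\<eta> = e / (I + 1)"
    have "0 < \<eta>" using \<open>0 < e\<close> \<open>0 \<le> I\<close> by (simp add: \<eta>_def)
    define b where "b = (\<lambda>\<omega>. a \<omega> + \<eta>)"
    have b0: "0 < b \<omega>" for \<omega> using a0[of \<omega>] \<open>0 < \<eta>\<close> by (simp add: b_def)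
    have [measurable]: "b \<in> borel_measurable F" "b \<in> borel_measurable M" unfolding b_def by auto
    have bU2: "integrable M (\<lambda>\<omega>. b \<omega> * (U \<omega>)\<^sup>2)"
      using aU2 U2 by (simp add: b_def distrib_right)
    have "(\<integral>\<^sup>+\<omega>. ennreal (1 / b \<omega> * (V \<omega>)\<^sup>2) \<partial>M) \<le> (\<integral>\<^sup>+\<omega>. ennreal (1 / b \<omega> * (a \<omega>)\<^sup>2 * (U \<omega>)\<^sup>2) \<partial>M)"
      by (rule wt) (use b0 in \<open>auto simp: less_imp_le\<close>)
    also have "\<dots> \<le> (\<integral>\<^sup>+\<omega>. ennreal (b \<omega> * (U \<omega>)\<^sup>2) \<partial>M)"
    proof (intro nn_integral_mono ennreal_leI mult_right_mono)
      fix \<omega>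
      have "(a \<omega>)\<^sup>2 \<le> (b \<omega>)\<^sup>2" using a0[of \<omega>] \<open>0 < \<eta>\<close> by (intro power_mono) (auto simp: b_def)
      then show "1 / b \<omega> * (a \<omega>)\<^sup>2 \<le> b \<omega>" using b0[of \<omega>] by (simp add: field_simps power2_eq_square)
    qed auto
    finally have le': "(\<integral>\<^sup>+\<omega>. ennreal (1 / b \<omega> * (V \<omega>)\<^sup>2) \<partial>M) \<le> (\<integral>\<^sup>+\<omega>. ennreal (b \<omega> * (U \<omega>)\<^sup>2) \<partial>M)" .
    have nn: "0 \<le> 1 / b \<omega> * (V \<omega>)\<^sup>2" "0 \<le> b \<omega> * (U \<omega>)\<^sup>2" for \<omega>
      using b0[of \<omega>] by (simp_all add: less_imp_le)
    have bV2: "integrable M (\<lambda>\<omega>. 1 / b \<omega> * (V \<omega>)\<^sup>2)"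
      and bUV: "(\<integral>\<omega>. 1 / b \<omega> * (V \<omega>)\<^sup>2 \<partial>M) \<le> (\<integral>\<omega>. b \<omega> * (U \<omega>)\<^sup>2 \<partial>M)"
      by (rule integrable_if_nn_integral_le[OF _ _ bU2 _ le']; use nn in simp)+
    have "U \<omega> * V \<omega> \<le> (b \<omega> * (U \<omega>)\<^sup>2 + 1 / b \<omega> * (V \<omega>)\<^sup>2) / 2" for \<omega>
    proof -
      have "0 \<le> (b \<omega> * U \<omega> - V \<omega>)\<^sup>2 / b \<omega>" using b0[of \<omega>] by simp
      also have "\<dots> = b \<omega> * (U \<omega>)\<^sup>2 + 1 / b \<omega> * (V \<omega>)\<^sup>2 - 2 * (U \<omega> * V \<omega>)"
        using b0[of \<omega>] by (simp add: power2_diff field_simps power2_eq_square)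
      finally show ?thesis by simp
    qed
    then have "(\<integral>\<omega>. U \<omega> * V \<omega> \<partial>M) \<le> (\<integral>\<omega>. (b \<omega> * (U \<omega>)\<^sup>2 + 1 / b \<omega> * (V \<omega>)\<^sup>2) / 2 \<partial>M)"
      using int bU2 bV2 by (intro integral_mono) auto
    also have "\<dots> = ((\<integral>\<omega>. b \<omega> * (U \<omega>)\<^sup>2 \<partial>M) + (\<integral>\<omega>. 1 / b \<omega> * (V \<omega>)\<^sup>2 \<partial>M)) / 2"
      using bU2 bV2 by simp
    also have "\<dots> \<le> (\<integral>\<omega>. b \<omega> * (U \<omega>)\<^sup>2 \<partial>M)" using bUV by simp
    also have "\<dots> = (\<integral>\<omega>. a \<omega> * (U \<omega>)\<^sup>2 \<partial>M) + \<eta> * I"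
      using aU2 U2 by (simp add: b_def distrib_right I_def)
    also have "\<eta> * I \<le> e" using \<open>0 < e\<close> \<open>0 \<le> I\<close> by (simp add: \<eta>_def field_simps)
    finally show "(\<integral>\<omega>. U \<omega> * V \<omega> \<partial>M) \<le> (\<integral>\<omega>. a \<omega> * (U \<omega>)\<^sup>2 \<partial>M) + e" by simp
  qed
qed

text \<open>The integrated form of \<open>E[t | F] \<ge> (1 - c) m\<close>. It is a consequence of \<open>m - t \<le> \<bar>t - m\<bar>\<close>, and
  all that is needed from the accuracy of the eigenvalue estimates.\<close>

lemma (in finite_measure_subalgebra) weighted_mean_lower_bound:
  fixes t m w :: "'a \<Rightarrow> real"
  assumes t: "integrable M t"
    and m[measurable]: "m \<in> borel_measurable F" and m0: "\<And>\<omega>. 0 \<le> m \<omega>" and mB: "\<And>\<omega>. m \<omega> \<le> B"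
    and w[measurable]: "w \<in> borel_measurable F" and w0: "\<And>\<omega>. 0 \<le> w \<omega>" and wK: "\<And>\<omega>. w \<omega> \<le> K"
    and "0 \<le> c"
    and le: "AE \<omega> in M. nn_cond_exp M F (\<lambda>\<omega>. ennreal \<bar>t \<omega> - m \<omega>\<bar>) \<omega> \<le> ennreal (c * m \<omega>)"
  shows "(1 - c) * (\<integral>\<omega>. w \<omega> * m \<omega> \<partial>M) \<le> (\<integral>\<omega>. w \<omega> * t \<omega> \<partial>M)"
proof -
  have [measurable]: "m \<in> borel_measurable M" "w \<in> borel_measurable M" "t \<in> borel_measurable M"
    using measurable_from_subalg[OF subalg m] measurable_from_subalg[OF subalg w] t by auto
  have mi: "integrable M m"
    using m0 mB by (intro integrable_const_bound[where B = B]) auto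
  have wm: "integrable M (\<lambda>\<omega>. w \<omega> * m \<omega>)" and wt: "integrable M (\<lambda>\<omega>. w \<omega> * t \<omega>)"
    by (rule integrable_bounded_mult[OF _ _ w0 wK]; use mi t in simp)+
  have cwm: "integrable M (\<lambda>\<omega>. w \<omega> * (c * m \<omega>))" using wm by (simp add: mult.left_commute)
  have "(\<integral>\<^sup>+\<omega>. ennreal (w \<omega> * \<bar>t \<omega> - m \<omega>\<bar>) \<partial>M) \<le> (\<integral>\<^sup>+\<omega>. ennreal (w \<omega> * (c * m \<omega>)) \<partial>M)"
    using nn_integral_le_if_nn_cond_exp_le_const[OF _ _ le, where w = "\<lambda>\<omega>. ennreal (w \<omega>)"] w0 m0 \<open>0 \<le> c\<close>
    by (simp add: ennreal_mult)
  then have dev: "integrable M (\<lambda>\<omega>. w \<omega> * \<bar>t \<omega> - m \<omega>\<bar>)"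
    "(\<integral>\<omega>. w \<omega> * \<bar>t \<omega> - m \<omega>\<bar> \<partial>M) \<le> (\<integral>\<omega>. w \<omega> * (c * m \<omega>) \<partial>M)"
    using integrable_if_nn_integral_le[OF _ _ cwm, of "\<lambda>\<omega>. w \<omega> * \<bar>t \<omega> - m \<omega>\<bar>"] w0 m0 \<open>0 \<le> c\<close>
    by auto
  have "(\<integral>\<omega>. w \<omega> * m \<omega> \<partial>M) - (\<integral>\<omega>. w \<omega> * t \<omega> \<partial>M) = (\<integral>\<omega>. w \<omega> * m \<omega> - w \<omega> * t \<omega> \<partial>M)"
    using wm wt by simp
  also have "\<dots> \<le> (\<integral>\<omega>. w \<omega> * \<bar>t \<omega> - m \<omega>\<bar> \<partial>M)"
    using w0 by (intro integral_mono[OF Bochner_Integration.integrable_diff[OF wm wt] dev(1)])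
      (auto simp flip: right_diff_distrib intro!: mult_left_mono)
  also have "\<dots> \<le> c * (\<integral>\<omega>. w \<omega> * m \<omega> \<partial>M)"
    using dev(2) by (simp add: mult.left_commute[of _ c])
  finally show ?thesis by (simp add: algebra_simps)
qed

text \<open>If \<open>s\<close> is the part of \<open>t\<close> guaranteed in conditional mean, then conditional Jensen and Chebyshev
  inequalities would give both claims. The polynomial inequalities
  \<open>(t - s)\<^sup>2 (t + s) \<ge> 0\<close> and \<open>(t - s)\<^sup>2 (t + 2 s) \<ge> 0\<close> are their pointwise versions, for which
  the single moment condition \<open>mean\<close> suffices.\<close>

lemma (in finite_measure) third_moment_bounds:
  fixes s t :: "'a \<Rightarrow> real"
  assumes [measurable]: "s \<in> borel_measurable M" and s0: "\<And>\<omega>. 0 \<le> s \<omega>" and sB: "\<And>\<omega>. s \<omega> \<le> B"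
    and [measurable]: "t \<in> borel_measurable M" and t0: "\<And>\<omega>. 0 \<le> t \<omega>"
    and t3: "integrable M (\<lambda>\<omega>. t \<omega> ^ 3)"
    and mean: "(\<integral>\<omega>. (s \<omega>)\<^sup>2 * s \<omega> \<partial>M) \<le> (\<integral>\<omega>. (s \<omega>)\<^sup>2 * t \<omega> \<partial>M)"
  shows "(\<integral>\<omega>. s \<omega> * (t \<omega>)\<^sup>2 \<partial>M) \<le> (\<integral>\<omega>. t \<omega> ^ 3 \<partial>M)"
    and "(\<integral>\<omega>. s \<omega> ^ 3 \<partial>M) \<le> (\<integral>\<omega>. t \<omega> ^ 3 \<partial>M)"
proof -
  have t1: "integrable M t" and t2: "integrable M (\<lambda>\<omega>. (t \<omega>)\<^sup>2)"
    using integrable_lower_power[OF _ t0 t3, of 1] integrable_lower_power[OF _ t0 t3, of 2] by simp_all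
  have s2B: "(s \<omega>)\<^sup>2 \<le> B\<^sup>2" for \<omega> using s0 sB by (intro power_mono)
  have s3: "integrable M (\<lambda>\<omega>. (s \<omega>)\<^sup>2 * s \<omega>)"
    by (rule integrable_bounded_mult[where B = "B\<^sup>2"])
      (use s2B s0 sB in \<open>auto intro!: integrable_const_bound[where B = B]\<close>)
  have s2t: "integrable M (\<lambda>\<omega>. (s \<omega>)\<^sup>2 * t \<omega>)"
    by (rule integrable_bounded_mult[OF t1, where B = "B\<^sup>2"]) (use s2B in auto)
  have st2: "integrable M (\<lambda>\<omega>. s \<omega> * (t \<omega>)\<^sup>2)"
    by (rule integrable_bounded_mult[OF t2 _ s0 sB]) auto
  have "(\<integral>\<omega>. s \<omega> * (t \<omega>)\<^sup>2 + ((s \<omega>)\<^sup>2 * t \<omega> - (s \<omega>)\<^sup>2 * s \<omega>) \<partial>M) \<le> (\<integral>\<omega>. t \<omega> ^ 3 \<partial>M)"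
  proof (intro integral_mono)
    fix \<omega>
    have "0 \<le> (t \<omega> - s \<omega>)\<^sup>2 * (t \<omega> + s \<omega>)" using s0 t0 by simp
    then show "s \<omega> * (t \<omega>)\<^sup>2 + ((s \<omega>)\<^sup>2 * t \<omega> - (s \<omega>)\<^sup>2 * s \<omega>) \<le> t \<omega> ^ 3"
      by (simp add: power2_eq_square power3_eq_cube algebra_simps)
  qed (use st2 s2t s3 t3 in auto)
  then show "(\<integral>\<omega>. s \<omega> * (t \<omega>)\<^sup>2 \<partial>M) \<le> (\<integral>\<omega>. t \<omega> ^ 3 \<partial>M)"
    using st2 s2t s3 mean by simp
  have "(\<integral>\<omega>. (s \<omega>)\<^sup>2 * s \<omega> + 3 * ((s \<omega>)\<^sup>2 * t \<omega> - (s \<omega>)\<^sup>2 * s \<omega>) \<partial>M) \<le> (\<integral>\<omega>. t \<omega> ^ 3 \<partial>M)"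
  proof (rule integral_mono[OF _ t3])
    show "integrable M (\<lambda>\<omega>. (s \<omega>)\<^sup>2 * s \<omega> + 3 * ((s \<omega>)\<^sup>2 * t \<omega> - (s \<omega>)\<^sup>2 * s \<omega>))"
      by (intro Bochner_Integration.integrable_add integrable_mult_right
          Bochner_Integration.integrable_diff s3 s2t)
    fix \<omega>
    have "0 \<le> (t \<omega> - s \<omega>)\<^sup>2 * (t \<omega> + 2 * s \<omega>)" using s0 t0 by simp
    then show "(s \<omega>)\<^sup>2 * s \<omega> + 3 * ((s \<omega>)\<^sup>2 * t \<omega> - (s \<omega>)\<^sup>2 * s \<omega>) \<le> t \<omega> ^ 3"
      by (simp add: power2_eq_square power3_eq_cube algebra_simps)
  qed
  also have "(\<integral>\<omega>. (s \<omega>)\<^sup>2 * s \<omega> + 3 * ((s \<omega>)\<^sup>2 * t \<omega> - (s \<omega>)\<^sup>2 * s \<omega>) \<partial>M)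
      = (\<integral>\<omega>. (s \<omega>)\<^sup>2 * s \<omega> \<partial>M) + 3 * ((\<integral>\<omega>. (s \<omega>)\<^sup>2 * t \<omega> \<partial>M) - (\<integral>\<omega>. (s \<omega>)\<^sup>2 * s \<omega> \<partial>M))"
    by (subst Bochner_Integration.integral_add)
      (simp_all only: s3 s2t Bochner_Integration.integrable_diff integrable_mult_right
        Bochner_Integration.integral_diff integral_mult_right_zero)
  finally have le: "(\<integral>\<omega>. (s \<omega>)\<^sup>2 * s \<omega> \<partial>M)
      + 3 * ((\<integral>\<omega>. (s \<omega>)\<^sup>2 * t \<omega> \<partial>M) - (\<integral>\<omega>. (s \<omega>)\<^sup>2 * s \<omega> \<partial>M)) \<le> (\<integral>\<omega>. t \<omega> ^ 3 \<partial>M)" .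
  from le mean have "(\<integral>\<omega>. (s \<omega>)\<^sup>2 * s \<omega> \<partial>M) \<le> (\<integral>\<omega>. t \<omega> ^ 3 \<partial>M)" by argo
  then show "(\<integral>\<omega>. s \<omega> ^ 3 \<partial>M) \<le> (\<integral>\<omega>. t \<omega> ^ 3 \<partial>M)"
    by (simp add: power3_eq_cube power2_eq_square)
qed

text \<open>In each component the weight \<open>G $ i\<close> is known to the conditioning \<open>\<sigma>\<close>-algebra, so \<open>X $ i\<close> may be
  replaced by its conditional expectation \<open>G $ i\<close>.\<close>

lemma (in sigma_finite_subalgebra) integral_inner_unbiased:
  fixes G X :: "'a \<Rightarrow> real^'n"
  assumes G[measurable]: "G \<in> borel_measurable F" and X[measurable]: "X \<in> borel_measurable M"
    and G2: "integrable M (\<lambda>\<omega>. (norm (G \<omega>))\<^sup>2)" and X2: "integrable M (\<lambda>\<omega>. (norm (X \<omega>))\<^sup>2)"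
    and unbiased: "\<And>i. AE \<omega> in M. real_cond_exp M F (\<lambda>\<omega>. X \<omega> $ i) \<omega> = G \<omega> $ i"
  shows "(\<integral>\<omega>. G \<omega> \<bullet> X \<omega> \<partial>M) = (\<integral>\<omega>. (norm (G \<omega>))\<^sup>2 \<partial>M)"
proof -
  have GM[measurable]: "G \<in> borel_measurable M" by (rule measurable_from_subalg[OF subalg G])
  have [measurable]: "(\<lambda>\<omega>. Y \<omega> $ i) \<in> borel_measurable N"
    if [measurable]: "Y \<in> borel_measurable N" for Y :: "'a \<Rightarrow> real^'n" and N i
    unfolding cart_eq_inner_axis by measurable
  have int: "integrable M (\<lambda>\<omega>. G \<omega> $ i * Y \<omega> $ i)"
    if [measurable]: "Y \<in> borel_measurable M" and Y2: "integrable M (\<lambda>\<omega>. (norm (Y \<omega>))\<^sup>2)"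
    for Y :: "'a \<Rightarrow> real^'n" and i
  proof (rule Bochner_Integration.integrable_bound)
    show "integrable M (\<lambda>\<omega>. (norm (G \<omega>))\<^sup>2 + (norm (Y \<omega>))\<^sup>2)" using G2 Y2 by simp
    have "\<bar>G \<omega> $ i * Y \<omega> $ i\<bar> \<le> (norm (G \<omega>))\<^sup>2 + (norm (Y \<omega>))\<^sup>2" for \<omega>
    proof -
      have "\<bar>G \<omega> $ i * Y \<omega> $ i\<bar> \<le> norm (G \<omega>) * norm (Y \<omega>)"
        unfolding abs_mult using component_le_norm_cart by (intro mult_mono) auto
      also have "2 * \<dots> \<le> (norm (G \<omega>))\<^sup>2 + (norm (Y \<omega>))\<^sup>2"
        using sum_squares_bound[of "norm (G \<omega>)" "norm (Y \<omega>)"] by simp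
      finally show ?thesis
        using zero_le_power2[of "norm (G \<omega>)"] zero_le_power2[of "norm (Y \<omega>)"] by linarith
    qed
    then show "AE \<omega> in M. norm (G \<omega> $ i * Y \<omega> $ i) \<le> norm ((norm (G \<omega>))\<^sup>2 + (norm (Y \<omega>))\<^sup>2)"
      by simp
  qed measurable
  have "(\<integral>\<omega>. G \<omega> $ i * X \<omega> $ i \<partial>M) = (\<integral>\<omega>. G \<omega> $ i * G \<omega> $ i \<partial>M)" for i
  proof -
    have "(\<integral>\<omega>. G \<omega> $ i * X \<omega> $ i \<partial>M) = (\<integral>\<omega>. G \<omega> $ i * real_cond_exp M F (\<lambda>\<omega>. X \<omega> $ i) \<omega> \<partial>M)"
      by (rule real_cond_exp_intg(2)[symmetric]) (use int[OF X X2] in auto)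
    also have "\<dots> = (\<integral>\<omega>. G \<omega> $ i * G \<omega> $ i \<partial>M)"
      using unbiased[of i] by (intro integral_cong_AE) auto
    finally show ?thesis .
  qed
  moreover have "(\<integral>\<omega>. G \<omega> \<bullet> Y \<omega> \<partial>M) = (\<Sum>i\<in>UNIV. \<integral>\<omega>. G \<omega> $ i * Y \<omega> $ i \<partial>M)"
    if "Y \<in> borel_measurable M" "integrable M (\<lambda>\<omega>. (norm (Y \<omega>))\<^sup>2)" for Y
    using int[OF that] by (simp add: inner_vec_def)
  ultimately show ?thesis
    using X X2 GM G2 by (simp add: power2_norm_eq_inner)
qed

text \<open>Jensen's inequality at the threshold \<open>\<epsilon>\<close>: by Bernoulli's inequality \<open>X ^ n\<close> lies above its
  tangent at \<open>\<epsilon>\<close>, and the tangent has mean at least \<open>\<epsilon> ^ n\<close>.\<close>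

lemma (in prob_space) power_le_expectation_power:
  fixes X :: "'a \<Rightarrow> real"
  assumes [measurable]: "X \<in> borel_measurable M" and X: "\<And>\<omega>. 0 \<le> X \<omega>"
    and int: "integrable M (\<lambda>\<omega>. X \<omega> ^ n)" and "1 \<le> n" and "0 < \<epsilon>"
    and gt: "ennreal \<epsilon> < (\<integral>\<^sup>+\<omega>. ennreal (X \<omega>) \<partial>M)"
  shows "\<epsilon> ^ n \<le> (\<integral>\<omega>. X \<omega> ^ n \<partial>M)"
proof -
  have X1: "integrable M X" using integrable_lower_power[OF _ X int \<open>1 \<le> n\<close>] by simp
  have "(\<integral>\<^sup>+\<omega>. ennreal (X \<omega>) \<partial>M) = ennreal (expectation X)"
    using X X1 by (intro nn_integral_eq_integral) auto
  with gt have gt': "\<epsilon> < expectation X" using \<open>0 < \<epsilon>\<close> by (simp add: ennreal_less_iff)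
  have "\<epsilon> ^ n * (1 + real n * (X \<omega> / \<epsilon> - 1)) \<le> X \<omega> ^ n" for \<omega>
  proof -
    have "1 + real n * (X \<omega> / \<epsilon> - 1) \<le> (1 + (X \<omega> / \<epsilon> - 1)) ^ n"
      using X[of \<omega>] \<open>0 < \<epsilon>\<close> by (intro Bernoulli_inequality) simp
    then have "\<epsilon> ^ n * (1 + real n * (X \<omega> / \<epsilon> - 1)) \<le> \<epsilon> ^ n * (X \<omega> / \<epsilon>) ^ n"
      using \<open>0 < \<epsilon>\<close> by (intro mult_left_mono) auto
    also have "\<dots> = X \<omega> ^ n" using \<open>0 < \<epsilon>\<close> by (simp flip: power_mult_distrib)
    finally show ?thesis .
  qed
  then have "expectation (\<lambda>\<omega>. \<epsilon> ^ n * (1 + real n * (X \<omega> / \<epsilon> - 1))) \<le> expectation (\<lambda>\<omega>. X \<omega> ^ n)"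
    using X1 int by (intro integral_mono) auto
  moreover have "expectation (\<lambda>\<omega>. \<epsilon> ^ n * (1 + real n * (X \<omega> / \<epsilon> - 1)))
      = \<epsilon> ^ n * (1 + real n * (expectation X / \<epsilon> - 1))"
    using X1 by (simp add: prob_space)
  moreover have "\<epsilon> ^ n * 1 \<le> \<epsilon> ^ n * (1 + real n * (expectation X / \<epsilon> - 1))"
    using gt' \<open>0 < \<epsilon>\<close> by (intro mult_left_mono) auto
  ultimately show ?thesis by linarith
qed


section \<open>Counting with summable sequences\<close>

lemma telescoping_descent_bound:
  fixes a b e :: "nat \<Rightarrow> real"
  assumes "\<And>k. a (Suc k) + b k \<le> a k + e k" and "\<And>k. l \<le> a k" and "\<And>k. 0 \<le> e k" and "summable e"
  shows "(\<Sum>k<N. b k) \<le> a 0 - l + suminf e"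
proof -
  have "a N + (\<Sum>k<N. b k) \<le> a 0 + (\<Sum>k<N. e k)"
  proof (induction N)
    case (Suc N)
    then show ?case using assms(1)[of N] by simp
  qed simp
  moreover have "(\<Sum>k<N. e k) \<le> suminf e" using assms by (intro sum_le_suminf) auto
  ultimately show ?thesis using assms(2)[of N] by linarith
qed

lemma finite_card_le_of_bounded_sums:
  fixes u :: "nat \<Rightarrow> real"
  assumes u: "\<And>k. 0 \<le> u k" and C: "\<And>N. (\<Sum>k<N. u k) \<le> C" and "0 < \<eta>"
    and S: "\<And>k. k \<in> S \<Longrightarrow> \<eta> \<le> u k"
  shows "finite S" and "real (card S) \<le> C / \<eta>"
proof -
  have card: "real (card T) \<le> C / \<eta>" if "T \<subseteq> S" "finite T" for T
  proof -
    obtain N where N: "T \<subseteq> {..<N}"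
      using \<open>finite T\<close> finite_nat_iff_bounded by blast
    have "\<eta> * real (card T) = (\<Sum>k\<in>T. \<eta>)" by simp
    also have "\<dots> \<le> (\<Sum>k\<in>T. u k)" using S \<open>T \<subseteq> S\<close> by (intro sum_mono) auto
    also have "\<dots> \<le> (\<Sum>k<N. u k)" using N u by (intro sum_mono2) auto
    also have "\<dots> \<le> C" by (rule C)
    finally show ?thesis using \<open>0 < \<eta>\<close> by (simp add: field_simps)
  qed
  have "card T \<le> nat \<lfloor>C / \<eta>\<rfloor>" if "T \<subseteq> S" "finite T" for T
    using card[OF that] by (simp add: le_nat_floor)
  then show "finite S" using finite_if_finite_subsets_card_bdd by blast
  then show "real (card S) \<le> C / \<eta>" using card by simp
qed

section \<open>One iteration of the stochastic two-step method\<close>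

lemma borel_measurable_matrix_vector_mult:
  fixes A :: "'a \<Rightarrow> real^'n^'m" and v :: "'a \<Rightarrow> real^'n"
  assumes "A \<in> borel_measurable N" and "v \<in> borel_measurable N"
  shows "(\<lambda>\<omega>. A \<omega> *v v \<omega>) \<in> borel_measurable N"
  using assms
  by (rule borel_measurable_continuous_Pair)
    (auto simp: matrix_vector_mult_def intro!: continuous_intros)

lemma borel_measurable_if_eq:
  assumes "\<And>\<omega>. \<omega> \<in> space N \<Longrightarrow> X \<omega> = Y \<omega>" and "Y \<in> borel_measurable N"
  shows "X \<in> borel_measurable N"
  using assms by (simp cong: measurable_cong)

text \<open>A run of the method with constant step sizes. The quantities estimated below are the true negative
  curvature \<open>curv\<close>, its estimate \<open>curv_est\<close> and the gradient \<open>grad_hat\<close> after the curvature step.\<close>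

locale two_step_run = prob_space M
  for M :: "'w measure" +
  fixes f :: "real^'n \<Rightarrow> real"
    and x0 :: "real^'n"
    and H :: "nat \<Rightarrow> 'w \<Rightarrow> real^'n^'n"
    and g q p ghat xhat x :: "nat \<Rightarrow> 'w \<Rightarrow> real^'n"
    and fbar Lg LH \<gamma> \<gamma>H \<gamma>l \<delta> \<theta> \<theta>hat \<alpha> \<beta> :: real
    and \<sigma> \<sigma>hat :: "nat \<Rightarrow> real"
  assumes f_C2: "twice_continuously_differentiable f"
    and Lg_pos: "0 < Lg" and grad_lipschitz: "Lg-lipschitz_on UNIV (gradient f)"
    and LH_pos: "0 < LH" and hess_lipschitz: "hessian_lipschitz LH f"
    and f_lower: "fbar \<le> f y"
    and gammaH_nonneg: "0 \<le> \<gamma>H"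
    and gammal: "0 \<le> \<gamma>l" "\<gamma>l < 1"
    and gammaH_less: "\<gamma>H < \<gamma> * (1 - \<gamma>l)"
    and delta_pos: "0 < \<delta>"
    and theta: "0 \<le> \<theta>" "\<theta> < 1"
    and sigma_summable: "summable (\<lambda>k. (\<sigma> k)\<^sup>2)"
    and sigmahat_summable: "summable (\<lambda>k. (\<sigma>hat k)\<^sup>2)"
    and alpha: "0 < \<alpha>" "\<alpha> \<le> 1 / (Lg * (1 + \<theta>hat\<^sup>2))"
    and beta: "0 < \<beta>" "\<beta> \<le> 3 * (\<gamma> - \<gamma>H / (1 - \<gamma>l)) / (2 * \<delta> * LH)"
    and run: "two_step_method M (\<lambda>_. \<alpha>) (\<lambda>_. \<beta>) x0 H p ghat xhat x"
    and condA: "condition_A M f \<gamma> \<delta> (\<lambda>_. \<theta>) \<sigma> H g q p x"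
    and condB: "condition_B M f \<gamma>H \<gamma>l H p x"
    and condC: "condition_C M f (\<lambda>_. \<theta>hat) \<sigma>hat ghat xhat x"
begin

definition curv :: "nat \<Rightarrow> 'w \<Rightarrow> real" where
  "curv k \<omega> = \<bar>lambda_min_neg (hessian f (x k \<omega>))\<bar>"

text \<open>On the sample space this is the absolute value of \<open>lambda_min_neg (H k \<omega>)\<close> (see
  \<open>lambda_min_neg_H_eq\<close>). Reading it off the length of \<open>q\<close> makes its measurability immediate, with no
  appeal to eigenvalues of random matrices.\<close>

definition curv_est :: "nat \<Rightarrow> 'w \<Rightarrow> real" where
  "curv_est k \<omega> = norm (q k \<omega>) / \<delta>"

definition grad_hat :: "nat \<Rightarrow> 'w \<Rightarrow> real^'n" where
  "grad_hat k \<omega> = gradient f (xhat k \<omega>)"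

definition curvature_margin :: real where
  "curvature_margin = \<gamma> - \<gamma>H / (1 - \<gamma>l)"

lemma f_differentiable: "f differentiable_on UNIV" "gradient f differentiable_on UNIV"
  using f_C2 by (auto simp: twice_continuously_differentiable_def)

lemma curvature_margin_pos: "0 < curvature_margin"
  using gammaH_less gammal by (simp add: curvature_margin_def field_simps)

subsection \<open>Measurability\<close>

lemma H_measurable[measurable]: "H k \<in> borel_measurable M"
  and ghat_measurable[measurable]: "ghat k \<in> borel_measurable M"
  using run by (auto simp: two_step_method_def)

lemma g_measurable[measurable]: "g k \<in> borel_measurable M"
  and q_measurable[measurable]: "q k \<in> borel_measurable M"
  using condA by (auto simp: condition_A_def)

lemma xhat_eq: "\<omega> \<in> space M \<Longrightarrow> xhat k \<omega> = x k \<omega> + \<beta> *\<^sub>R p k \<omega>"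
  and x_Suc_eq: "\<omega> \<in> space M \<Longrightarrow> x (Suc k) \<omega> = xhat k \<omega> + \<alpha> *\<^sub>R (- ghat k \<omega>)"
  and x_0_eq: "\<omega> \<in> space M \<Longrightarrow> x 0 \<omega> = x0"
  using run by (auto simp: two_step_method_def)

lemmas curvature_direction = condA[unfolded condition_A_def, THEN conjunct2, THEN conjunct1, rule_format]

lemma q_eq_0:
  assumes "\<omega> \<in> space M" and "0 \<le> lambda_min (H k \<omega>)"
  shows "q k \<omega> = 0"
  using curvature_direction[OF assms(1), of k] assms(2) by simp

lemma q_curvature:
  assumes "\<omega> \<in> space M" and "lambda_min (H k \<omega>) < 0"
  shows "q k \<omega> \<bullet> (H k \<omega> *v q k \<omega>) \<le> \<gamma> * lambda_min (H k \<omega>) * (norm (q k \<omega>))\<^sup>2"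
    and "norm (q k \<omega>) = \<delta> * \<bar>lambda_min (H k \<omega>)\<bar>"
  using curvature_direction[OF assms(1), of k, unfolded if_not_P[OF not_le[THEN iffD2, OF assms(2)]]]
  by blast+

text \<open>The sign rule also covers the case of no negative curvature, where \<open>q\<close> and \<open>p\<close> both vanish.\<close>

lemma p_eq: "\<omega> \<in> space M \<Longrightarrow> p k \<omega> = (if g k \<omega> \<bullet> q k \<omega> \<le> 0 then q k \<omega> else - q k \<omega>)"
  using curvature_direction[of \<omega> k] by (simp split: if_splits)

lemma p_measurable[measurable]: "p k \<in> borel_measurable M"
proof (rule borel_measurable_if_eq[OF p_eq])
  show "(\<lambda>\<omega>. if g k \<omega> \<bullet> q k \<omega> \<le> 0 then q k \<omega> else - q k \<omega>) \<in> borel_measurable M"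
    by measurable
qed

lemma x_measurable[measurable]: "x k \<in> borel_measurable M"
  and xhat_measurable[measurable]: "xhat k \<in> borel_measurable M"
proof -
  have hat: "xhat k \<in> borel_measurable M" if [measurable]: "x k \<in> borel_measurable M" for k
    by (rule borel_measurable_if_eq[OF xhat_eq]) measurable
  have "x k \<in> borel_measurable M" for k
  proof (induction k)
    case 0
    show ?case by (rule borel_measurable_if_eq[OF x_0_eq]) measurable
  next
    case (Suc k)
    note hat[OF Suc.IH, measurable]
    show ?case by (rule borel_measurable_if_eq[OF x_Suc_eq]) measurable
  qed
  then show "x k \<in> borel_measurable M" and "xhat k \<in> borel_measurable M"
    using hat by auto
qed

lemma f_borel[measurable]: "f \<in> borel_measurable borel"
  using f_differentiable(1) differentiable_imp_continuous_on
  by (intro borel_measurable_continuous_onI) blast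

lemma gradient_borel[measurable]: "gradient f \<in> borel_measurable borel"
  using f_differentiable(2) differentiable_imp_continuous_on
  by (intro borel_measurable_continuous_onI) blast

lemma hessian_borel[measurable]: "hessian f \<in> borel_measurable borel"
  using f_C2 by (intro borel_measurable_continuous_onI) (simp add: twice_continuously_differentiable_def)

lemma lambda_min_hessian_borel[measurable]: "(\<lambda>y. lambda_min (hessian f y)) \<in> borel_measurable borel"
  using lambda_min_hessian_lipschitz[OF f_C2 hess_lipschitz] LH_pos
  by (intro borel_measurable_continuous_onI lipschitz_on_continuous_on) auto

lemma subalgebra_F_k: "subalgebra M (F_k M x k)"
  unfolding F_k_def by (rule subalgebra_sigma_of) auto

lemma subalgebra_F_k_and:
  assumes "Y \<in> borel_measurable M"
  shows "subalgebra M (F_k_and M x k Y)"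
  unfolding F_k_and_def by (rule subalgebra_sigma_of) (use assms in auto)

lemma curv_measurable: "curv k \<in> borel_measurable (F_k M x k)"
proof -
  have [measurable]: "x k \<in> borel_measurable (F_k M x k)"
    unfolding F_k_def by (rule measurable_sigma_of) auto
  show ?thesis unfolding curv_def lambda_min_neg_def by measurable
qed

lemma curv_measurable_M[measurable]: "curv k \<in> borel_measurable M"
  using curv_measurable subalgebra_F_k by (rule measurable_from_subalg[rotated])

lemma curv_est_measurable[measurable]: "curv_est k \<in> borel_measurable M"
  unfolding curv_est_def by measurable

lemma grad_hat_measurable: "grad_hat k \<in> borel_measurable (F_k_and M x k (xhat k))"
proof -
  have [measurable]: "xhat k \<in> borel_measurable (F_k_and M x k (xhat k))"
    unfolding F_k_and_def by (rule measurable_sigma_of) auto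
  show ?thesis unfolding grad_hat_def by measurable
qed

lemma grad_hat_measurable_M[measurable]: "grad_hat k \<in> borel_measurable M"
  unfolding grad_hat_def by measurable

lemma curv_nonneg: "0 \<le> curv k \<omega>" and curv_le: "curv k \<omega> \<le> Lg"
  using abs_lambda_min_hessian_le[OF f_C2 grad_lipschitz, of "x k \<omega>"] Lg_pos
  by (auto simp: curv_def lambda_min_neg_def)

lemma curv_est_nonneg: "0 \<le> curv_est k \<omega>"
  using delta_pos by (simp add: curv_est_def)

lemma norm_p_eq: "\<omega> \<in> space M \<Longrightarrow> norm (p k \<omega>) = \<delta> * curv_est k \<omega>"
  using delta_pos by (simp add: p_eq curv_est_def)

lemma lambda_min_neg_H_eq:
  assumes "\<omega> \<in> space M"
  shows "lambda_min_neg (H k \<omega>) = - curv_est k \<omega>"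
proof (cases "0 \<le> lambda_min (H k \<omega>)")
  case True
  then have "q k \<omega> = 0" by (rule q_eq_0[OF assms])
  then show ?thesis using True by (simp add: lambda_min_neg_def curv_est_def)
next
  case False
  then have "norm (q k \<omega>) = \<delta> * \<bar>lambda_min (H k \<omega>)\<bar>"
    using q_curvature(2)[OF assms] by simp
  then show ?thesis using False delta_pos by (simp add: lambda_min_neg_def curv_est_def)
qed

lemma p_H_p_le:
  assumes "\<omega> \<in> space M"
  shows "p k \<omega> \<bullet> (H k \<omega> *v p k \<omega>) \<le> - \<gamma> * \<delta>\<^sup>2 * curv_est k \<omega> ^ 3"
proof (cases "0 \<le> lambda_min (H k \<omega>)")
  case True
  then have "q k \<omega> = 0" by (rule q_eq_0[OF assms])
  then show ?thesis using p_eq[OF assms] by (simp add: curv_est_def)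
next
  case False
  then have "q k \<omega> \<bullet> (H k \<omega> *v q k \<omega>) \<le> \<gamma> * lambda_min (H k \<omega>) * (norm (q k \<omega>))\<^sup>2"
    using q_curvature(1)[OF assms] by simp
  moreover have "p k \<omega> \<bullet> (H k \<omega> *v p k \<omega>) = q k \<omega> \<bullet> (H k \<omega> *v q k \<omega>)"
    using matrix_vector_mult_scaleR[of "H k \<omega>" "-1" "q k \<omega>"] by (simp add: p_eq[OF assms])
  moreover have "lambda_min (H k \<omega>) = - curv_est k \<omega>"
    using lambda_min_neg_H_eq[OF assms, of k] False by (simp add: lambda_min_neg_def)
  moreover have "norm (q k \<omega>) = \<delta> * curv_est k \<omega>" using delta_pos by (simp add: curv_est_def)
  ultimately show ?thesis
    by (simp add: power_mult_distrib power2_eq_square power3_eq_cube mult_ac)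
qed

subsection \<open>The negative curvature step\<close>

definition hess_err :: "nat \<Rightarrow> 'w \<Rightarrow> real" where
  "hess_err k \<omega> = norm ((H k \<omega> - hessian f (x k \<omega>)) *v p k \<omega>)"

definition slope_err :: "nat \<Rightarrow> 'w \<Rightarrow> real" where
  "slope_err k \<omega> = \<bar>(g k \<omega> - gradient f (x k \<omega>)) \<bullet> q k \<omega>\<bar>"

lemma hess_err_measurable[measurable]: "hess_err k \<in> borel_measurable M"
  unfolding hess_err_def
  by (intro borel_measurable_norm[THEN measurable_compose_rev]
      borel_measurable_matrix_vector_mult) measurable

lemma slope_err_measurable[measurable]: "slope_err k \<in> borel_measurable M"
  unfolding slope_err_def by measurable

text \<open>The coefficient of the cube of the estimated curvature that is gained in one curvature step, before
  the Hessian error is taken into account: the quadratic gain minus the cubic Taylor remainder.\<close>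

definition cubic_gain :: real where
  "cubic_gain = \<beta>\<^sup>2 * \<delta>\<^sup>2 * \<gamma> / 2 - LH * \<beta> ^ 3 * \<delta> ^ 3 / 6"

text \<open>The bound on \<open>\<beta>\<close> lets the Taylor remainder use up at most half of the quadratic gain left after the
  Hessian error.\<close>

lemma cubic_gain_ge:
  "\<beta>\<^sup>2 * \<delta>\<^sup>2 * curvature_margin / 4 \<le> cubic_gain - \<beta>\<^sup>2 * \<delta>\<^sup>2 / 2 * (\<gamma>H / (1 - \<gamma>l))"
proof -
  have "LH * \<beta> * \<delta> \<le> 3 / 2 * curvature_margin"
    using beta delta_pos LH_pos by (simp add: curvature_margin_def field_simps)
  then have "\<beta>\<^sup>2 * \<delta>\<^sup>2 / 6 * (LH * \<beta> * \<delta>) \<le> \<beta>\<^sup>2 * \<delta>\<^sup>2 / 6 * (3 / 2 * curvature_margin)"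
    by (intro mult_left_mono) auto
  then have "LH * \<beta> ^ 3 * \<delta> ^ 3 / 6 \<le> \<beta>\<^sup>2 * \<delta>\<^sup>2 * curvature_margin / 4"
    by (simp add: power2_eq_square power3_eq_cube mult_ac)
  moreover have "\<beta>\<^sup>2 * \<delta>\<^sup>2 * \<gamma> / 2 = \<beta>\<^sup>2 * \<delta>\<^sup>2 / 2 * curvature_margin + \<beta>\<^sup>2 * \<delta>\<^sup>2 / 2 * (\<gamma>H / (1 - \<gamma>l))"
    unfolding curvature_margin_def distrib_left[symmetric] by simp
  ultimately show ?thesis
    unfolding cubic_gain_def by argo
qed

lemma cubic_gain_pos: "0 < cubic_gain"
proof -
  have "0 < \<beta>\<^sup>2 * \<delta>\<^sup>2 * curvature_margin / 4"
    using beta delta_pos curvature_margin_pos by simp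
  moreover have "0 \<le> \<beta>\<^sup>2 * \<delta>\<^sup>2 / 2 * (\<gamma>H / (1 - \<gamma>l))"
    using gammaH_nonneg gammal by simp
  ultimately show ?thesis using cubic_gain_ge by linarith
qed

text \<open>Cubic Taylor bound along \<open>\<beta> p\<close>. By the choice of sign, the first-order term is at most the error
  of the estimated slope minus its absolute value.\<close>

lemma curvature_step_pointwise:
  assumes "\<omega> \<in> space M"
  shows "f (xhat k \<omega>) + cubic_gain * curv_est k \<omega> ^ 3
    \<le> f (x k \<omega>) + \<beta> * (slope_err k \<omega> - \<bar>g k \<omega> \<bullet> q k \<omega>\<bar>)
      + \<beta>\<^sup>2 / 2 * (norm (p k \<omega>) * hess_err k \<omega>)"
proof -
  let ?G = "gradient f (x k \<omega>)" and ?A = "hessian f (x k \<omega>)"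
  let ?p = "p k \<omega>" and ?H = "H k \<omega>" and ?t = "curv_est k \<omega>"
  have slope: "?G \<bullet> ?p \<le> slope_err k \<omega> - \<bar>g k \<omega> \<bullet> q k \<omega>\<bar>"
    by (auto simp: p_eq[OF assms] slope_err_def inner_diff_left)
  have "?p \<bullet> (?A *v ?p) = ?p \<bullet> (?H *v ?p) + ?p \<bullet> ((?A - ?H) *v ?p)"
    by (simp add: matrix_vector_mult_diff_rdistrib inner_diff_right)
  moreover have "?p \<bullet> ((?A - ?H) *v ?p) \<le> norm ?p * hess_err k \<omega>"
  proof -
    have "norm ((?A - ?H) *v ?p) = hess_err k \<omega>"
      by (simp add: hess_err_def matrix_vector_mult_diff_rdistrib norm_minus_commute)
    then show ?thesis using norm_cauchy_schwarz[of ?p "(?A - ?H) *v ?p"] by simp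
  qed
  ultimately have quad: "?p \<bullet> (?A *v ?p) \<le> norm ?p * hess_err k \<omega> - \<gamma> * \<delta>\<^sup>2 * ?t ^ 3"
    using p_H_p_le[OF assms, of k] by simp
  have "f (xhat k \<omega>) \<le> f (x k \<omega>) + ?G \<bullet> (\<beta> *\<^sub>R ?p) + ((\<beta> *\<^sub>R ?p) \<bullet> (?A *v (\<beta> *\<^sub>R ?p))) / 2
      + LH / 6 * norm (\<beta> *\<^sub>R ?p) ^ 3"
    unfolding xhat_eq[OF assms] by (rule hessian_taylor_upper[OF f_C2 hess_lipschitz])
  also have "\<dots> = f (x k \<omega>) + \<beta> * (?G \<bullet> ?p) + \<beta>\<^sup>2 / 2 * (?p \<bullet> (?A *v ?p))
      + LH / 6 * (\<beta> ^ 3 * (\<delta> ^ 3 * ?t ^ 3))"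
    using beta by (simp add: matrix_vector_mult_scaleR norm_p_eq[OF assms] power_mult_distrib power2_eq_square)
  also have "\<dots> \<le> f (x k \<omega>) + \<beta> * (slope_err k \<omega> - \<bar>g k \<omega> \<bullet> q k \<omega>\<bar>)
      + \<beta>\<^sup>2 / 2 * (norm ?p * hess_err k \<omega> - \<gamma> * \<delta>\<^sup>2 * ?t ^ 3) + LH / 6 * (\<beta> ^ 3 * (\<delta> ^ 3 * ?t ^ 3))"
    using slope quad beta by (intro add_mono mult_left_mono order_refl) auto
  finally show ?thesis by (simp add: cubic_gain_def algebra_simps)
qed

text \<open>Condition (A) in total expectation. Since \<open>\<theta> < 1\<close>, the slope error exceeds the absolute value
  of the estimated slope by at most \<open>(\<sigma> k)\<^sup>2\<close> in the mean.\<close>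

lemma slope_err_expectation:
  shows "integrable M (slope_err k)"
    and "expectation (slope_err k) \<le> \<theta>\<^sup>2 * expectation (\<lambda>\<omega>. \<bar>g k \<omega> \<bullet> q k \<omega>\<bar>) + (\<sigma> k)\<^sup>2"
proof -
  interpret F: finite_measure_subalgebra M "F_k_and M x k (q k)"
    by unfold_locales (rule subalgebra_F_k_and[OF q_measurable])
  have int: "integrable M (\<lambda>\<omega>. \<theta>\<^sup>2 * \<bar>g k \<omega> \<bullet> q k \<omega>\<bar> + (\<sigma> k)\<^sup>2)"
    using condA by (auto simp: condition_A_def)
  define E where "E = nn_cond_exp M (F_k_and M x k (q k)) (\<lambda>\<omega>. ennreal \<bar>g k \<omega> \<bullet> q k \<omega>\<bar>)"
  have [measurable]: "E \<in> borel_measurable M" unfolding E_def by measurable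
  have "AE \<omega> in M. nn_cond_exp M (F_k_and M x k (q k)) (\<lambda>\<omega>. ennreal (slope_err k \<omega>)) \<omega>
      \<le> ennreal (\<theta>\<^sup>2) * E \<omega> + ennreal ((\<sigma> k)\<^sup>2)"
    using condA by (simp add: condition_A_def slope_err_def E_def)
  from F.nn_integral_le_if_nn_cond_exp_le_const[OF _ _ this, of "\<lambda>_. 1"]
  have "(\<integral>\<^sup>+\<omega>. ennreal (slope_err k \<omega>) \<partial>M) \<le> (\<integral>\<^sup>+\<omega>. ennreal (\<theta>\<^sup>2) * E \<omega> + ennreal ((\<sigma> k)\<^sup>2) \<partial>M)"
    by simp
  also have "\<dots> = ennreal (\<theta>\<^sup>2) * (\<integral>\<^sup>+\<omega>. E \<omega> \<partial>M) + ennreal ((\<sigma> k)\<^sup>2)"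
    by (simp add: nn_integral_add nn_integral_cmult emeasure_space_1)
  also have "(\<integral>\<^sup>+\<omega>. E \<omega> \<partial>M) = (\<integral>\<^sup>+\<omega>. ennreal \<bar>g k \<omega> \<bullet> q k \<omega>\<bar> \<partial>M)"
    unfolding E_def using F.nn_cond_exp_intg[of "\<lambda>_. 1" "\<lambda>\<omega>. ennreal \<bar>g k \<omega> \<bullet> q k \<omega>\<bar>"] by simp
  also have "ennreal (\<theta>\<^sup>2) * \<dots> + ennreal ((\<sigma> k)\<^sup>2) = (\<integral>\<^sup>+\<omega>. ennreal (\<theta>\<^sup>2 * \<bar>g k \<omega> \<bullet> q k \<omega>\<bar> + (\<sigma> k)\<^sup>2) \<partial>M)"
    by (simp add: ennreal_mult nn_integral_add nn_integral_cmult emeasure_space_1)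
  finally have le: "(\<integral>\<^sup>+\<omega>. ennreal (slope_err k \<omega>) \<partial>M)
      \<le> (\<integral>\<^sup>+\<omega>. ennreal (\<theta>\<^sup>2 * \<bar>g k \<omega> \<bullet> q k \<omega>\<bar> + (\<sigma> k)\<^sup>2) \<partial>M)" .
  have nn: "0 \<le> slope_err k \<omega>" for \<omega> by (simp add: slope_err_def)
  show "integrable M (slope_err k)"
    by (rule integrable_if_nn_integral_le(1)[OF _ _ int _ le]) (auto simp: nn)
  have "expectation (slope_err k) \<le> expectation (\<lambda>\<omega>. \<theta>\<^sup>2 * \<bar>g k \<omega> \<bullet> q k \<omega>\<bar> + (\<sigma> k)\<^sup>2)"
    by (rule integrable_if_nn_integral_le(2)[OF _ _ int _ le]) (auto simp: nn)
  also have "\<dots> = \<theta>\<^sup>2 * expectation (\<lambda>\<omega>. \<bar>g k \<omega> \<bullet> q k \<omega>\<bar>) + (\<sigma> k)\<^sup>2"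
    using condA by (simp add: condition_A_def prob_space)
  finally show "expectation (slope_err k) \<le> \<theta>\<^sup>2 * expectation (\<lambda>\<omega>. \<bar>g k \<omega> \<bullet> q k \<omega>\<bar>) + (\<sigma> k)\<^sup>2" .
qed

text \<open>The first part of condition (B), through the conditional Cauchy-Schwarz inequality.\<close>

lemma hess_err_expectation:
  shows "integrable M (\<lambda>\<omega>. norm (p k \<omega>) * hess_err k \<omega>)"
    and "expectation (\<lambda>\<omega>. norm (p k \<omega>) * hess_err k \<omega>)
      \<le> \<gamma>H * \<delta>\<^sup>2 * expectation (\<lambda>\<omega>. curv k \<omega> * (curv_est k \<omega>)\<^sup>2)"
proof -
  interpret F: finite_measure_subalgebra M "F_k M x k"
    by unfold_locales (rule subalgebra_F_k)
  note [measurable] = curv_measurable[of k]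
  have meas: "(\<lambda>\<omega>. \<gamma>H * curv k \<omega>) \<in> borel_measurable (F_k M x k)" by measurable
  have p2: "integrable M (\<lambda>\<omega>. (norm (p k \<omega>))\<^sup>2)" using condB by (simp add: condition_B_def)
  have le: "AE \<omega> in M. nn_cond_exp M (F_k M x k) (\<lambda>\<omega>. ennreal ((hess_err k \<omega>)\<^sup>2)) \<omega>
      \<le> ennreal ((\<gamma>H * curv k \<omega>)\<^sup>2) * nn_cond_exp M (F_k M x k) (\<lambda>\<omega>. ennreal ((norm (p k \<omega>))\<^sup>2)) \<omega>"
    using condB by (simp add: condition_B_def hess_err_def curv_def power_mult_distrib)
  have bd: "0 \<le> \<gamma>H * curv k \<omega>" "\<gamma>H * curv k \<omega> \<le> \<gamma>H * Lg" for \<omega>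
    using gammaH_nonneg curv_nonneg curv_le by (auto intro: mult_left_mono)
  note cs = F.conditional_cauchy_schwarz[OF _ hess_err_measurable meas bd p2 le]
  show "integrable M (\<lambda>\<omega>. norm (p k \<omega>) * hess_err k \<omega>)" by (rule cs(1)) measurable
  have "expectation (\<lambda>\<omega>. norm (p k \<omega>) * hess_err k \<omega>) \<le> expectation (\<lambda>\<omega>. \<gamma>H * curv k \<omega> * (norm (p k \<omega>))\<^sup>2)"
    by (rule cs(2)) measurable
  also have "\<dots> = expectation (\<lambda>\<omega>. \<gamma>H * \<delta>\<^sup>2 * (curv k \<omega> * (curv_est k \<omega>)\<^sup>2))"
    by (rule Bochner_Integration.integral_cong) (auto simp: norm_p_eq power_mult_distrib)
  finally show "expectation (\<lambda>\<omega>. norm (p k \<omega>) * hess_err k \<omega>)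
      \<le> \<gamma>H * \<delta>\<^sup>2 * expectation (\<lambda>\<omega>. curv k \<omega> * (curv_est k \<omega>)\<^sup>2)"
    by simp
qed

text \<open>The second part of condition (B): in conditional mean the estimated curvature is at least \<open>1 - \<gamma>l\<close>
  times the true one.\<close>

lemma curv_est_moments:
  assumes t3: "integrable M (\<lambda>\<omega>. curv_est k \<omega> ^ 3)"
  shows "expectation (\<lambda>\<omega>. curv k \<omega> * (curv_est k \<omega>)\<^sup>2)
      \<le> expectation (\<lambda>\<omega>. curv_est k \<omega> ^ 3) / (1 - \<gamma>l)"
    and "(1 - \<gamma>l) ^ 3 * expectation (\<lambda>\<omega>. curv k \<omega> ^ 3) \<le> expectation (\<lambda>\<omega>. curv_est k \<omega> ^ 3)"
proof -
  interpret F: finite_measure_subalgebra M "F_k M x k"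
    by unfold_locales (rule subalgebra_F_k)
  note [measurable] = curv_measurable[of k]
  \<comment> \<open>The part of the estimated curvature that is guaranteed in conditional mean.\<close>
  define s where "s = (\<lambda>\<omega>. (1 - \<gamma>l) * curv k \<omega>)"
  have [measurable]: "s \<in> borel_measurable M" "s \<in> borel_measurable (F_k M x k)"
    unfolding s_def by measurable
  have s0: "0 \<le> s \<omega>" and sB: "s \<omega> \<le> (1 - \<gamma>l) * Lg" for \<omega>
    using gammal curv_nonneg curv_le by (auto simp: s_def intro!: mult_left_mono)
  have t1: "integrable M (curv_est k)"
    using integrable_lower_power[OF _ _ t3, of 1] curv_est_nonneg by simp
  let ?dev = "\<lambda>\<omega>. ennreal \<bar>lambda_min_neg (H k \<omega>) - lambda_min_neg (hessian f (x k \<omega>))\<bar>"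
  let ?dev' = "\<lambda>\<omega>. ennreal \<bar>curv_est k \<omega> - curv k \<omega>\<bar>"
  have eq: "?dev \<omega> = ?dev' \<omega>" if "\<omega> \<in> space M" for \<omega>
  proof -
    have "lambda_min_neg (hessian f (x k \<omega>)) = - curv k \<omega>" by (simp add: curv_def lambda_min_neg_def)
    then show ?thesis by (simp add: lambda_min_neg_H_eq[OF that] abs_minus_commute)
  qed
  have "AE \<omega> in M. nn_cond_exp M (F_k M x k) ?dev \<omega> = nn_cond_exp M (F_k M x k) ?dev' \<omega>"
  proof (rule F.nn_cond_exp_cong)
    show "?dev \<in> borel_measurable M" by (rule borel_measurable_if_eq[OF eq]) measurable
  qed (use eq in auto)
  moreover have "AE \<omega> in M. nn_cond_exp M (F_k M x k) ?dev \<omega> \<le> ennreal (\<gamma>l * curv k \<omega>)"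
    using condB by (simp add: condition_B_def curv_def)
  ultimately have dev: "AE \<omega> in M. nn_cond_exp M (F_k M x k) ?dev' \<omega> \<le> ennreal (\<gamma>l * curv k \<omega>)"
    by eventually_elim simp
  have "(1 - \<gamma>l) * expectation (\<lambda>\<omega>. (s \<omega>)\<^sup>2 * curv k \<omega>) \<le> expectation (\<lambda>\<omega>. (s \<omega>)\<^sup>2 * curv_est k \<omega>)"
    by (rule F.weighted_mean_lower_bound[OF t1 _ curv_nonneg curv_le _ _ _ gammal(1) dev,
          where K = "((1 - \<gamma>l) * Lg)\<^sup>2"])
      (auto intro!: power_mono s0 sB)
  moreover have "(1 - \<gamma>l) * expectation (\<lambda>\<omega>. (s \<omega>)\<^sup>2 * curv k \<omega>) = expectation (\<lambda>\<omega>. (s \<omega>)\<^sup>2 * s \<omega>)"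
    by (simp add: s_def mult.left_commute flip: integral_mult_right_zero)
  ultimately have mean: "expectation (\<lambda>\<omega>. (s \<omega>)\<^sup>2 * s \<omega>) \<le> expectation (\<lambda>\<omega>. (s \<omega>)\<^sup>2 * curv_est k \<omega>)"
    by simp
  have "expectation (\<lambda>\<omega>. s \<omega> * (curv_est k \<omega>)\<^sup>2) \<le> expectation (\<lambda>\<omega>. curv_est k \<omega> ^ 3)"
    and "expectation (\<lambda>\<omega>. s \<omega> ^ 3) \<le> expectation (\<lambda>\<omega>. curv_est k \<omega> ^ 3)"
    by (rule third_moment_bounds[OF _ s0 sB _ curv_est_nonneg t3 mean]; measurable)+
  moreover have "expectation (\<lambda>\<omega>. s \<omega> * (curv_est k \<omega>)\<^sup>2)
      = (1 - \<gamma>l) * expectation (\<lambda>\<omega>. curv k \<omega> * (curv_est k \<omega>)\<^sup>2)"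
    and "expectation (\<lambda>\<omega>. s \<omega> ^ 3) = (1 - \<gamma>l) ^ 3 * expectation (\<lambda>\<omega>. curv k \<omega> ^ 3)"
    by (simp_all only: s_def power_mult_distrib mult.assoc integral_mult_right_zero)
  ultimately show "expectation (\<lambda>\<omega>. curv k \<omega> * (curv_est k \<omega>)\<^sup>2)
      \<le> expectation (\<lambda>\<omega>. curv_est k \<omega> ^ 3) / (1 - \<gamma>l)"
    and "(1 - \<gamma>l) ^ 3 * expectation (\<lambda>\<omega>. curv k \<omega> ^ 3) \<le> expectation (\<lambda>\<omega>. curv_est k \<omega> ^ 3)"
    using gammal by (simp_all add: pos_le_divide_eq mult.commute)
qed

definition curvature_decrease :: real where
  "curvature_decrease = \<beta>\<^sup>2 * \<delta>\<^sup>2 * curvature_margin / 4 * (1 - \<gamma>l) ^ 3"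

lemma curvature_decrease_pos: "0 < curvature_decrease"
  using beta delta_pos curvature_margin_pos gammal by (simp add: curvature_decrease_def)

text \<open>Integrability of \<open>curv_est k\<close> cubed is not part of the conditions. It follows from the pointwise
  inequality, because \<open>f\<close> is bounded below and everything on the right-hand side is integrable. Then
  the expected Hessian error can be absorbed into the cubic gain.\<close>

lemma curvature_step:
  assumes fx: "integrable M (\<lambda>\<omega>. f (x k \<omega>))"
  shows "integrable M (\<lambda>\<omega>. f (xhat k \<omega>))"
    and "expectation (\<lambda>\<omega>. f (xhat k \<omega>)) + curvature_decrease * expectation (\<lambda>\<omega>. curv k \<omega> ^ 3)
      \<le> expectation (\<lambda>\<omega>. f (x k \<omega>)) + \<beta> * (\<sigma> k)\<^sup>2"
proof -
  have gq: "integrable M (\<lambda>\<omega>. \<bar>g k \<omega> \<bullet> q k \<omega>\<bar>)"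
    using condA by (auto simp: condition_A_def)
  let ?R = "\<lambda>\<omega>. f (x k \<omega>) + \<beta> * (slope_err k \<omega> - \<bar>g k \<omega> \<bullet> q k \<omega>\<bar>)
      + \<beta>\<^sup>2 / 2 * (norm (p k \<omega>) * hess_err k \<omega>)"
  have R: "integrable M ?R"
    using fx gq slope_err_expectation(1) hess_err_expectation(1)
    by (intro Bochner_Integration.integrable_add integrable_mult_right Bochner_Integration.integrable_diff)
  have t0: "0 \<le> curv_est k \<omega> ^ 3" for \<omega> using curv_est_nonneg by simp
  show fxhat: "integrable M (\<lambda>\<omega>. f (xhat k \<omega>))"
  proof (rule integrable_if_sandwiched[OF _ R, where Z = "\<lambda>_. fbar"])
    fix \<omega> assume "\<omega> \<in> space M"
    from curvature_step_pointwise[OF this, of k] mult_nonneg_nonneg[OF less_imp_le[OF cubic_gain_pos] t0, of \<omega>]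
    show "f (xhat k \<omega>) \<le> ?R \<omega>" by linarith
  qed (auto simp: f_lower)
  have t3: "integrable M (\<lambda>\<omega>. curv_est k \<omega> ^ 3)"
  proof (rule integrable_if_sandwiched[where Z = "\<lambda>_. 0"])
    show "integrable M (\<lambda>\<omega>. (?R \<omega> - fbar) / cubic_gain)" using R by simp
    fix \<omega> assume "\<omega> \<in> space M"
    from curvature_step_pointwise[OF this, of k] f_lower[of "xhat k \<omega>"]
    have "cubic_gain * curv_est k \<omega> ^ 3 \<le> ?R \<omega> - fbar" by linarith
    then show "curv_est k \<omega> ^ 3 \<le> (?R \<omega> - fbar) / cubic_gain"
      using cubic_gain_pos by (simp add: pos_le_divide_eq mult.commute)
  qed (use t0 in auto)
  define T where "T = expectation (\<lambda>\<omega>. curv_est k \<omega> ^ 3)"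
  define S where "S = expectation (\<lambda>\<omega>. \<bar>g k \<omega> \<bullet> q k \<omega>\<bar>)"
  have "0 \<le> S" by (simp add: S_def)
  have "expectation (\<lambda>\<omega>. f (xhat k \<omega>)) + cubic_gain * T
      = expectation (\<lambda>\<omega>. f (xhat k \<omega>) + cubic_gain * curv_est k \<omega> ^ 3)"
    unfolding T_def using fxhat t3 by simp
  also have "\<dots> \<le> expectation ?R"
    using fxhat t3 R curvature_step_pointwise by (intro integral_mono) auto
  also have "\<dots> = expectation (\<lambda>\<omega>. f (x k \<omega>)) + \<beta> * (expectation (slope_err k) - S)
      + \<beta>\<^sup>2 / 2 * expectation (\<lambda>\<omega>. norm (p k \<omega>) * hess_err k \<omega>)"
    unfolding S_def using fx gq slope_err_expectation(1)[of k] hess_err_expectation(1)[of k] by simp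
  also have "\<dots> \<le> expectation (\<lambda>\<omega>. f (x k \<omega>)) + \<beta> * (\<sigma> k)\<^sup>2
      + \<beta>\<^sup>2 / 2 * (\<gamma>H * \<delta>\<^sup>2 * (T / (1 - \<gamma>l)))"
  proof (intro add_mono mult_left_mono order_refl)
    have "\<theta>\<^sup>2 * S \<le> 1 * S"
      using theta \<open>0 \<le> S\<close> by (intro mult_right_mono) (auto simp: power_le_one)
    then show "expectation (slope_err k) - S \<le> (\<sigma> k)\<^sup>2"
      using slope_err_expectation(2)[of k] by (simp add: S_def)
    have "\<gamma>H * \<delta>\<^sup>2 * expectation (\<lambda>\<omega>. curv k \<omega> * (curv_est k \<omega>)\<^sup>2) \<le> \<gamma>H * \<delta>\<^sup>2 * (T / (1 - \<gamma>l))"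
      using curv_est_moments(1)[OF t3] gammaH_nonneg by (intro mult_left_mono) (auto simp: T_def)
    with hess_err_expectation(2)[of k]
    show "expectation (\<lambda>\<omega>. norm (p k \<omega>) * hess_err k \<omega>) \<le> \<gamma>H * \<delta>\<^sup>2 * (T / (1 - \<gamma>l))" by linarith
  qed (use beta in auto)
  finally have "expectation (\<lambda>\<omega>. f (xhat k \<omega>)) + (cubic_gain - \<beta>\<^sup>2 * \<delta>\<^sup>2 / 2 * (\<gamma>H / (1 - \<gamma>l))) * T
      \<le> expectation (\<lambda>\<omega>. f (x k \<omega>)) + \<beta> * (\<sigma> k)\<^sup>2"
    by (simp add: algebra_simps)
  moreover have "curvature_decrease * expectation (\<lambda>\<omega>. curv k \<omega> ^ 3)
      \<le> (cubic_gain - \<beta>\<^sup>2 * \<delta>\<^sup>2 / 2 * (\<gamma>H / (1 - \<gamma>l))) * T"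
  proof -
    have "curvature_decrease * expectation (\<lambda>\<omega>. curv k \<omega> ^ 3)
        = \<beta>\<^sup>2 * \<delta>\<^sup>2 * curvature_margin / 4 * ((1 - \<gamma>l) ^ 3 * expectation (\<lambda>\<omega>. curv k \<omega> ^ 3))"
      by (simp add: curvature_decrease_def)
    also have "\<dots> \<le> \<beta>\<^sup>2 * \<delta>\<^sup>2 * curvature_margin / 4 * T"
      using curv_est_moments(2)[OF t3] curvature_margin_pos unfolding T_def
      by (intro mult_left_mono) auto
    also have "\<dots> \<le> (cubic_gain - \<beta>\<^sup>2 * \<delta>\<^sup>2 / 2 * (\<gamma>H / (1 - \<gamma>l))) * T"
      using cubic_gain_ge t0 unfolding T_def by (intro mult_right_mono) (auto intro: integral_nonneg_AE)
    finally show ?thesis .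
  qed
  ultimately show "expectation (\<lambda>\<omega>. f (xhat k \<omega>)) + curvature_decrease * expectation (\<lambda>\<omega>. curv k \<omega> ^ 3)
      \<le> expectation (\<lambda>\<omega>. f (x k \<omega>)) + \<beta> * (\<sigma> k)\<^sup>2"
    by linarith
qed

subsection \<open>The gradient step\<close>

definition grad_err :: "nat \<Rightarrow> 'w \<Rightarrow> real^'n" where
  "grad_err k \<omega> = ghat k \<omega> - grad_hat k \<omega>"

lemma grad_err_measurable[measurable]: "grad_err k \<in> borel_measurable M"
  unfolding grad_err_def by measurable

text \<open>Condition (C) in total expectation: relative variance bound, and orthogonality of the error to the
  gradient by unbiasedness.\<close>

lemma grad_err_moments:
  assumes G2: "integrable M (\<lambda>\<omega>. (norm (grad_hat k \<omega>))\<^sup>2)"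
  shows "integrable M (\<lambda>\<omega>. (norm (grad_err k \<omega>))\<^sup>2)"
    and "expectation (\<lambda>\<omega>. (norm (grad_err k \<omega>))\<^sup>2)
      \<le> \<theta>hat\<^sup>2 * expectation (\<lambda>\<omega>. (norm (grad_hat k \<omega>))\<^sup>2) + (\<sigma>hat k)\<^sup>2"
    and "integrable M (\<lambda>\<omega>. grad_hat k \<omega> \<bullet> grad_err k \<omega>)"
    and "expectation (\<lambda>\<omega>. grad_hat k \<omega> \<bullet> grad_err k \<omega>) = 0"
proof -
  interpret F: finite_measure_subalgebra M "F_k_and M x k (xhat k)"
    by unfold_locales (rule subalgebra_F_k_and[OF xhat_measurable])
  let ?B = "\<lambda>\<omega>. \<theta>hat\<^sup>2 * (norm (grad_hat k \<omega>))\<^sup>2 + (\<sigma>hat k)\<^sup>2"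
  have B: "integrable M ?B" using G2 by simp
  have "AE \<omega> in M. nn_cond_exp M (F_k_and M x k (xhat k)) (\<lambda>\<omega>. ennreal ((norm (grad_err k \<omega>))\<^sup>2)) \<omega>
      \<le> ennreal (?B \<omega>)"
    using condC by (simp add: condition_C_def grad_err_def grad_hat_def)
  from F.nn_integral_le_if_nn_cond_exp_le_const[OF _ _ this, of "\<lambda>_. 1"]
  have le: "(\<integral>\<^sup>+\<omega>. ennreal ((norm (grad_err k \<omega>))\<^sup>2) \<partial>M) \<le> (\<integral>\<^sup>+\<omega>. ennreal (?B \<omega>) \<partial>M)" by simp
  show e2: "integrable M (\<lambda>\<omega>. (norm (grad_err k \<omega>))\<^sup>2)"
    by (rule integrable_if_nn_integral_le(1)[OF _ _ B _ le]) auto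
  have "expectation (\<lambda>\<omega>. (norm (grad_err k \<omega>))\<^sup>2) \<le> expectation ?B"
    by (rule integrable_if_nn_integral_le(2)[OF _ _ B _ le]) auto
  then show "expectation (\<lambda>\<omega>. (norm (grad_err k \<omega>))\<^sup>2)
      \<le> \<theta>hat\<^sup>2 * expectation (\<lambda>\<omega>. (norm (grad_hat k \<omega>))\<^sup>2) + (\<sigma>hat k)\<^sup>2"
    using G2 by (simp add: prob_space)
  have sq: "(norm (u + v))\<^sup>2 \<le> 2 * (norm u)\<^sup>2 + 2 * (norm v)\<^sup>2" for u v :: "real^'n"
    using zero_le_power2[of "norm (u - v)"] unfolding power2_norm_eq_inner
    by (simp add: inner_add_left inner_add_right inner_diff_left inner_diff_right inner_commute)
  have ghat2: "integrable M (\<lambda>\<omega>. (norm (ghat k \<omega>))\<^sup>2)"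
  proof (rule integrable_if_sandwiched[where Z = "\<lambda>_. 0"])
    show "integrable M (\<lambda>\<omega>. 2 * (norm (grad_hat k \<omega>))\<^sup>2 + 2 * (norm (grad_err k \<omega>))\<^sup>2)" using G2 e2 by simp
    show "(norm (ghat k \<omega>))\<^sup>2 \<le> 2 * (norm (grad_hat k \<omega>))\<^sup>2 + 2 * (norm (grad_err k \<omega>))\<^sup>2" for \<omega>
      using sq[of "grad_hat k \<omega>" "grad_err k \<omega>"] by (simp add: grad_err_def)
  qed auto
  have inner_int: "integrable M (\<lambda>\<omega>. grad_hat k \<omega> \<bullet> Y \<omega>)"
    if "Y \<in> borel_measurable M" and Y2: "integrable M (\<lambda>\<omega>. (norm (Y \<omega>))\<^sup>2)" for Y :: "'w \<Rightarrow> real^'n"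
  proof (rule Bochner_Integration.integrable_bound)
    show "integrable M (\<lambda>\<omega>. (norm (grad_hat k \<omega>))\<^sup>2 + (norm (Y \<omega>))\<^sup>2)" using G2 Y2 by simp
    have "\<bar>u \<bullet> v\<bar> \<le> (norm u)\<^sup>2 + (norm v)\<^sup>2" for u v :: "real^'n"
      using Cauchy_Schwarz_ineq2[of u v] sum_squares_bound[of "norm u" "norm v"]
        mult_nonneg_nonneg[OF norm_ge_zero[of u] norm_ge_zero[of v]] by linarith
    then show "AE \<omega> in M. norm (grad_hat k \<omega> \<bullet> Y \<omega>) \<le> norm ((norm (grad_hat k \<omega>))\<^sup>2 + (norm (Y \<omega>))\<^sup>2)"
      by simp
  qed (use that in measurable)
  show "integrable M (\<lambda>\<omega>. grad_hat k \<omega> \<bullet> grad_err k \<omega>)" by (rule inner_int[OF _ e2]) measurable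
  have "expectation (\<lambda>\<omega>. grad_hat k \<omega> \<bullet> ghat k \<omega>) = expectation (\<lambda>\<omega>. (norm (grad_hat k \<omega>))\<^sup>2)"
    by (rule F.integral_inner_unbiased[OF grad_hat_measurable _ G2 ghat2])
      (use condC in \<open>auto simp: condition_C_def grad_hat_def\<close>)
  then show "expectation (\<lambda>\<omega>. grad_hat k \<omega> \<bullet> grad_err k \<omega>) = 0"
    using inner_int[OF _ ghat2] G2
    by (simp add: grad_err_def inner_diff_right dot_square_norm)
qed

lemma alpha_Lg_le: "Lg * \<alpha> * (1 + \<theta>hat\<^sup>2) \<le> 1" "Lg * \<alpha> \<le> 1"
proof -
  have pos: "0 < 1 + \<theta>hat\<^sup>2" by (simp add: add_pos_nonneg)
  show 1: "Lg * \<alpha> * (1 + \<theta>hat\<^sup>2) \<le> 1"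
    using alpha(2) Lg_pos pos by (simp add: pos_le_divide_eq mult_ac)
  have "Lg * \<alpha> * 1 \<le> Lg * \<alpha> * (1 + \<theta>hat\<^sup>2)"
    using alpha Lg_pos by (intro mult_left_mono) auto
  then show "Lg * \<alpha> \<le> 1" using 1 by simp
qed

lemma gradient_step_pointwise:
  assumes "\<omega> \<in> space M"
  shows "f (x (Suc k) \<omega>) \<le> f (xhat k \<omega>) - (\<alpha> - Lg * \<alpha>\<^sup>2 / 2) * (norm (grad_hat k \<omega>))\<^sup>2
      - (\<alpha> - Lg * \<alpha>\<^sup>2) * (grad_hat k \<omega> \<bullet> grad_err k \<omega>) + Lg * \<alpha>\<^sup>2 / 2 * (norm (grad_err k \<omega>))\<^sup>2"
proof -
  let ?G = "grad_hat k \<omega>" and ?e = "grad_err k \<omega>"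
  have step: "x (Suc k) \<omega> = xhat k \<omega> + (- \<alpha>) *\<^sub>R (?G + ?e)"
    using x_Suc_eq[OF assms] by (simp add: grad_err_def)
  have "f (x (Suc k) \<omega>) \<le> f (xhat k \<omega>) + ?G \<bullet> ((- \<alpha>) *\<^sub>R (?G + ?e))
      + Lg / 2 * (norm ((- \<alpha>) *\<^sub>R (?G + ?e)))\<^sup>2"
    unfolding step grad_hat_def by (rule descent_lemma[OF f_differentiable(1) grad_lipschitz])
  also have "(norm ((- \<alpha>) *\<^sub>R (?G + ?e)))\<^sup>2
      = \<alpha>\<^sup>2 * ((norm ?G)\<^sup>2 + 2 * (?G \<bullet> ?e) + (norm ?e)\<^sup>2)"
    unfolding power2_norm_eq_inner
    by (simp add: inner_add_left inner_add_right inner_commute power2_eq_square algebra_simps)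
  also have "?G \<bullet> ((- \<alpha>) *\<^sub>R (?G + ?e)) = - \<alpha> * ((norm ?G)\<^sup>2 + ?G \<bullet> ?e)"
    by (simp add: inner_add_right dot_square_norm)
  finally show ?thesis by (simp add: algebra_simps)
qed

text \<open>The error enters only through its second moment, and \<open>Lg \<alpha> (1 + \<theta>hat\<^sup>2) \<le> 1\<close> keeps half of the
  first-order decrease.\<close>

lemma gradient_step:
  assumes fxhat: "integrable M (\<lambda>\<omega>. f (xhat k \<omega>))"
  shows "integrable M (\<lambda>\<omega>. (norm (grad_hat k \<omega>))\<^sup>2)"
    and "integrable M (\<lambda>\<omega>. f (x (Suc k) \<omega>))"
    and "expectation (\<lambda>\<omega>. f (x (Suc k) \<omega>)) + \<alpha> / 2 * expectation (\<lambda>\<omega>. (norm (grad_hat k \<omega>))\<^sup>2)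
      \<le> expectation (\<lambda>\<omega>. f (xhat k \<omega>)) + Lg * \<alpha>\<^sup>2 / 2 * (\<sigma>hat k)\<^sup>2"
proof -
  show G2: "integrable M (\<lambda>\<omega>. (norm (grad_hat k \<omega>))\<^sup>2)"
  proof (rule integrable_if_sandwiched[where Z = "\<lambda>_. 0"])
    show "integrable M (\<lambda>\<omega>. 2 * Lg * (f (xhat k \<omega>) - fbar))" using fxhat by simp
    show "(norm (grad_hat k \<omega>))\<^sup>2 \<le> 2 * Lg * (f (xhat k \<omega>) - fbar)" for \<omega>
      unfolding grad_hat_def
      by (rule gradient_norm_sq_le_gap[OF f_differentiable(1) grad_lipschitz Lg_pos f_lower])
  qed auto
  note e = grad_err_moments[OF G2]
  let ?R = "\<lambda>\<omega>. f (xhat k \<omega>) - (\<alpha> - Lg * \<alpha>\<^sup>2 / 2) * (norm (grad_hat k \<omega>))\<^sup>2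
      - (\<alpha> - Lg * \<alpha>\<^sup>2) * (grad_hat k \<omega> \<bullet> grad_err k \<omega>) + Lg * \<alpha>\<^sup>2 / 2 * (norm (grad_err k \<omega>))\<^sup>2"
  have R: "integrable M ?R"
    by (intro Bochner_Integration.integrable_add Bochner_Integration.integrable_diff
        integrable_mult_right fxhat G2 e(1,3))
  show fx: "integrable M (\<lambda>\<omega>. f (x (Suc k) \<omega>))"
    by (rule integrable_if_sandwiched[OF _ R, where Z = "\<lambda>_. fbar"])
      (use gradient_step_pointwise f_lower in auto)
  define N where "N = expectation (\<lambda>\<omega>. (norm (grad_hat k \<omega>))\<^sup>2)"
  have "0 \<le> N" by (simp add: N_def)
  have "expectation (\<lambda>\<omega>. f (x (Suc k) \<omega>)) \<le> expectation ?R"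
    using fx R gradient_step_pointwise by (intro integral_mono) auto
  also have "\<dots> = expectation (\<lambda>\<omega>. f (xhat k \<omega>)) - (\<alpha> - Lg * \<alpha>\<^sup>2 / 2) * N
      + Lg * \<alpha>\<^sup>2 / 2 * expectation (\<lambda>\<omega>. (norm (grad_err k \<omega>))\<^sup>2)"
    using fxhat G2 e unfolding N_def
    by (simp add: Bochner_Integration.integrable_diff Bochner_Integration.integrable_add)
  also have "\<dots> \<le> expectation (\<lambda>\<omega>. f (xhat k \<omega>)) - (\<alpha> - Lg * \<alpha>\<^sup>2 / 2) * N
      + Lg * \<alpha>\<^sup>2 / 2 * (\<theta>hat\<^sup>2 * N + (\<sigma>hat k)\<^sup>2)"
    using e(2) Lg_pos by (intro add_mono mult_left_mono order_refl) (auto simp: N_def)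
  also have "\<dots> = expectation (\<lambda>\<omega>. f (xhat k \<omega>)) - \<alpha> * N
      + \<alpha> / 2 * N * (Lg * \<alpha> * (1 + \<theta>hat\<^sup>2)) + Lg * \<alpha>\<^sup>2 / 2 * (\<sigma>hat k)\<^sup>2"
    by (simp add: algebra_simps power2_eq_square)
  also have "\<alpha> / 2 * N * (Lg * \<alpha> * (1 + \<theta>hat\<^sup>2)) \<le> \<alpha> / 2 * N * 1"
    using alpha alpha_Lg_le(1) \<open>0 \<le> N\<close> by (intro mult_left_mono) auto
  finally show "expectation (\<lambda>\<omega>. f (x (Suc k) \<omega>)) + \<alpha> / 2 * expectation (\<lambda>\<omega>. (norm (grad_hat k \<omega>))\<^sup>2)
      \<le> expectation (\<lambda>\<omega>. f (xhat k \<omega>)) + Lg * \<alpha>\<^sup>2 / 2 * (\<sigma>hat k)\<^sup>2"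
    by (simp add: N_def)
qed

text \<open>The decrease controls the gradient at \<open>xhat k\<close>, whereas the claim concerns the iterates. Going back
  from \<open>xhat k\<close> to \<open>x k\<close> would cost a multiple of the squared length of \<open>p k\<close>, and only third powers of
  the curvature are summable. Going forward to \<open>x (Suc k)\<close> costs a multiple of the squared length of
  \<open>ghat k\<close>, which the gradient at \<open>xhat k\<close> and \<open>\<sigma>hat k\<close> already control.\<close>

lemma next_gradient_moment:
  assumes G2: "integrable M (\<lambda>\<omega>. (norm (grad_hat k \<omega>))\<^sup>2)"
  shows "integrable M (\<lambda>\<omega>. (norm (gradient f (x (Suc k) \<omega>)))\<^sup>2)"
    and "expectation (\<lambda>\<omega>. (norm (gradient f (x (Suc k) \<omega>)))\<^sup>2)
      \<le> (8 + 2 * \<theta>hat\<^sup>2) * expectation (\<lambda>\<omega>. (norm (grad_hat k \<omega>))\<^sup>2) + 2 * (\<sigma>hat k)\<^sup>2"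
proof -
  note e = grad_err_moments[OF G2]
  let ?R = "\<lambda>\<omega>. 8 * (norm (grad_hat k \<omega>))\<^sup>2 + 2 * (norm (grad_err k \<omega>))\<^sup>2"
  have R: "integrable M ?R" using G2 e(1) by simp
  have le: "(norm (gradient f (x (Suc k) \<omega>)))\<^sup>2 \<le> ?R \<omega>" if "\<omega> \<in> space M" for \<omega>
  proof -
    let ?G = "grad_hat k \<omega>" and ?e = "grad_err k \<omega>"
    have step: "x (Suc k) \<omega> - xhat k \<omega> = (- \<alpha>) *\<^sub>R (?G + ?e)"
      using x_Suc_eq[OF that] by (simp add: grad_err_def)
    have "norm (gradient f (x (Suc k) \<omega>) - ?G) \<le> Lg * norm (x (Suc k) \<omega> - xhat k \<omega>)"
      using lipschitz_onD[OF grad_lipschitz, of "x (Suc k) \<omega>" "xhat k \<omega>"]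
      by (simp add: dist_norm grad_hat_def)
    also have "\<dots> = Lg * \<alpha> * norm (?G + ?e)" unfolding step using alpha by simp
    also have "\<dots> \<le> 1 * norm (?G + ?e)" by (intro mult_right_mono alpha_Lg_le(2)) simp
    also have "\<dots> \<le> norm ?G + norm ?e" using norm_triangle_ineq by simp
    finally have "norm (gradient f (x (Suc k) \<omega>)) \<le> 2 * norm ?G + norm ?e"
      using norm_triangle_sub[of "gradient f (x (Suc k) \<omega>)" ?G] by linarith
    then have "(norm (gradient f (x (Suc k) \<omega>)))\<^sup>2 \<le> (2 * norm ?G + norm ?e)\<^sup>2"
      by (intro power_mono) auto
    also have "\<dots> \<le> ?R \<omega>"
      using zero_le_power2[of "2 * norm ?G - norm ?e"] by (simp add: power2_eq_square algebra_simps)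
    finally show ?thesis .
  qed
  show int: "integrable M (\<lambda>\<omega>. (norm (gradient f (x (Suc k) \<omega>)))\<^sup>2)"
    by (rule integrable_if_sandwiched[OF _ R, where Z = "\<lambda>_. 0"]) (use le in auto)
  have "expectation (\<lambda>\<omega>. (norm (gradient f (x (Suc k) \<omega>)))\<^sup>2) \<le> expectation ?R"
    using int R le by (intro integral_mono) auto
  also have "\<dots> = 8 * expectation (\<lambda>\<omega>. (norm (grad_hat k \<omega>))\<^sup>2)
      + 2 * expectation (\<lambda>\<omega>. (norm (grad_err k \<omega>))\<^sup>2)"
    using G2 e(1) by simp
  finally show "expectation (\<lambda>\<omega>. (norm (gradient f (x (Suc k) \<omega>)))\<^sup>2)
      \<le> (8 + 2 * \<theta>hat\<^sup>2) * expectation (\<lambda>\<omega>. (norm (grad_hat k \<omega>))\<^sup>2) + 2 * (\<sigma>hat k)\<^sup>2"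
    using e(2) by (simp add: algebra_simps)
qed

subsection \<open>Summation over all iterations\<close>

lemma integrable_f_iterates: "integrable M (\<lambda>\<omega>. f (x k \<omega>))"
proof (induction k)
  case 0
  have "integrable M (\<lambda>\<omega>. f (x 0 \<omega>)) \<longleftrightarrow> integrable M (\<lambda>_. f x0)"
    by (rule Bochner_Integration.integrable_cong) (auto simp: x_0_eq)
  then show ?case by simp
next
  case (Suc k)
  then show ?case by (intro gradient_step(2) curvature_step(1))
qed

lemmas integrable_grad_hat_sq = gradient_step(1)[OF curvature_step(1)[OF integrable_f_iterates]]

definition total_decrease :: real where
  "total_decrease = f x0 - fbar + (\<Sum>k. \<beta> * (\<sigma> k)\<^sup>2 + Lg * \<alpha>\<^sup>2 / 2 * (\<sigma>hat k)\<^sup>2)"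

text \<open>Telescoping both steps: the total decrease available is \<open>f x0 - fbar\<close> plus the summed noise.\<close>

lemma sum_decrease_le:
  "(\<Sum>k<N. curvature_decrease * expectation (\<lambda>\<omega>. curv k \<omega> ^ 3)
      + \<alpha> / 2 * expectation (\<lambda>\<omega>. (norm (grad_hat k \<omega>))\<^sup>2)) \<le> total_decrease"
proof -
  have "expectation (\<lambda>\<omega>. f (x 0 \<omega>)) = expectation (\<lambda>_. f x0)"
    by (rule Bochner_Integration.integral_cong) (auto simp: x_0_eq)
  then have f0: "expectation (\<lambda>\<omega>. f (x 0 \<omega>)) = f x0" by (simp add: prob_space)
  show ?thesis
    unfolding total_decrease_def f0[symmetric]
  proof (rule telescoping_descent_bound[where a = "\<lambda>k. expectation (\<lambda>\<omega>. f (x k \<omega>))"])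
    fix k
    show "expectation (\<lambda>\<omega>. f (x (Suc k) \<omega>)) + (curvature_decrease * expectation (\<lambda>\<omega>. curv k \<omega> ^ 3)
        + \<alpha> / 2 * expectation (\<lambda>\<omega>. (norm (grad_hat k \<omega>))\<^sup>2))
      \<le> expectation (\<lambda>\<omega>. f (x k \<omega>)) + (\<beta> * (\<sigma> k)\<^sup>2 + Lg * \<alpha>\<^sup>2 / 2 * (\<sigma>hat k)\<^sup>2)"
      using curvature_step(2)[OF integrable_f_iterates, of k]
        gradient_step(3)[OF curvature_step(1)[OF integrable_f_iterates], of k] by linarith
    have "expectation (\<lambda>_. fbar) \<le> expectation (\<lambda>\<omega>. f (x k \<omega>))"
      using integrable_f_iterates by (intro integral_mono) (auto simp: f_lower)
    then show "fbar \<le> expectation (\<lambda>\<omega>. f (x k \<omega>))" by (simp add: prob_space)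
    show "0 \<le> \<beta> * (\<sigma> k)\<^sup>2 + Lg * \<alpha>\<^sup>2 / 2 * (\<sigma>hat k)\<^sup>2" using beta Lg_pos by simp
    show "summable (\<lambda>k. \<beta> * (\<sigma> k)\<^sup>2 + Lg * \<alpha>\<^sup>2 / 2 * (\<sigma>hat k)\<^sup>2)"
      by (intro summable_add summable_mult sigma_summable sigmahat_summable)
  qed
qed

lemma expectation_curv_nonneg: "0 \<le> expectation (\<lambda>\<omega>. curv k \<omega> ^ 3)"
  by (intro integral_nonneg_AE AE_I2 zero_le_power curv_nonneg)

lemma sum_curv_le: "(\<Sum>k<N. expectation (\<lambda>\<omega>. curv k \<omega> ^ 3)) \<le> total_decrease / curvature_decrease"
proof -
  have "curvature_decrease * (\<Sum>k<N. expectation (\<lambda>\<omega>. curv k \<omega> ^ 3))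
      \<le> (\<Sum>k<N. curvature_decrease * expectation (\<lambda>\<omega>. curv k \<omega> ^ 3)
          + \<alpha> / 2 * expectation (\<lambda>\<omega>. (norm (grad_hat k \<omega>))\<^sup>2))"
    unfolding sum_distrib_left using alpha by (intro sum_mono) simp
  then show ?thesis
    using sum_decrease_le[of N] curvature_decrease_pos by (simp add: pos_le_divide_eq mult.commute)
qed

lemma sum_grad_hat_le: "(\<Sum>k<N. expectation (\<lambda>\<omega>. (norm (grad_hat k \<omega>))\<^sup>2)) \<le> 2 * total_decrease / \<alpha>"
proof -
  have "\<alpha> / 2 * (\<Sum>k<N. expectation (\<lambda>\<omega>. (norm (grad_hat k \<omega>))\<^sup>2))
      \<le> (\<Sum>k<N. curvature_decrease * expectation (\<lambda>\<omega>. curv k \<omega> ^ 3)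
          + \<alpha> / 2 * expectation (\<lambda>\<omega>. (norm (grad_hat k \<omega>))\<^sup>2))"
    unfolding sum_distrib_left using curvature_decrease_pos expectation_curv_nonneg
    by (intro sum_mono) simp
  then show ?thesis
    using sum_decrease_le[of N] alpha by (simp add: pos_le_divide_eq mult.commute)
qed

lemma integrable_gradient_sq: "integrable M (\<lambda>\<omega>. (norm (gradient f (x k \<omega>)))\<^sup>2)"
proof (cases k)
  case 0
  have "integrable M (\<lambda>\<omega>. (norm (gradient f (x 0 \<omega>)))\<^sup>2) \<longleftrightarrow> integrable M (\<lambda>_. (norm (gradient f x0))\<^sup>2)"
    by (rule Bochner_Integration.integrable_cong) (auto simp: x_0_eq)
  then show ?thesis using 0 by simp
next
  case (Suc j)
  then show ?thesis using next_gradient_moment(1)[OF integrable_grad_hat_sq] by simp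
qed

definition gradient_budget :: real where
  "gradient_budget = (norm (gradient f x0))\<^sup>2 + (8 + 2 * \<theta>hat\<^sup>2) * (2 * total_decrease / \<alpha>)
      + 2 * (\<Sum>k. (\<sigma>hat k)\<^sup>2)"

lemma sum_gradient_le: "(\<Sum>k<N. expectation (\<lambda>\<omega>. (norm (gradient f (x k \<omega>)))\<^sup>2)) \<le> gradient_budget"
proof -
  let ?u = "\<lambda>k. expectation (\<lambda>\<omega>. (norm (gradient f (x k \<omega>)))\<^sup>2)"
  have "expectation (\<lambda>\<omega>. (norm (gradient f (x 0 \<omega>)))\<^sup>2) = expectation (\<lambda>_. (norm (gradient f x0))\<^sup>2)"
    by (rule Bochner_Integration.integral_cong) (auto simp: x_0_eq)
  then have u0: "?u 0 = (norm (gradient f x0))\<^sup>2" by (simp add: prob_space)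
  have "(\<Sum>k<N. ?u k) \<le> (\<Sum>k<Suc N. ?u k)" by simp
  also have "\<dots> = ?u 0 + (\<Sum>k<N. ?u (Suc k))" by (rule sum.lessThan_Suc_shift)
  also have "(\<Sum>k<N. ?u (Suc k))
      \<le> (\<Sum>k<N. (8 + 2 * \<theta>hat\<^sup>2) * expectation (\<lambda>\<omega>. (norm (grad_hat k \<omega>))\<^sup>2) + 2 * (\<sigma>hat k)\<^sup>2)"
    by (intro sum_mono next_gradient_moment(2) integrable_grad_hat_sq)
  also have "\<dots> = (8 + 2 * \<theta>hat\<^sup>2) * (\<Sum>k<N. expectation (\<lambda>\<omega>. (norm (grad_hat k \<omega>))\<^sup>2))
      + 2 * (\<Sum>k<N. (\<sigma>hat k)\<^sup>2)"
    by (simp only: sum.distrib sum_distrib_left)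
  also have "\<dots> \<le> (8 + 2 * \<theta>hat\<^sup>2) * (2 * total_decrease / \<alpha>) + 2 * (\<Sum>k. (\<sigma>hat k)\<^sup>2)"
    using sum_grad_hat_le sum_le_suminf[OF sigmahat_summable]
    by (intro add_mono mult_left_mono) auto
  finally show ?thesis by (simp add: gradient_budget_def u0)
qed

subsection \<open>Complexity bounds\<close>

lemma G_index_bound:
  assumes "0 < \<epsilon>"
  shows "finite (G_index M f x \<epsilon>)" and "real (card (G_index M f x \<epsilon>)) \<le> gradient_budget * (1 / \<epsilon> ^ 2)"
proof -
  have mem: "\<epsilon> ^ 2 \<le> expectation (\<lambda>\<omega>. (norm (gradient f (x k \<omega>)))\<^sup>2)" if "k \<in> G_index M f x \<epsilon>" for k
    using that by (intro power_le_expectation_power[OF _ _ integrable_gradient_sq _ assms])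
      (auto simp: G_index_def)
  have "0 < \<epsilon> ^ 2" using assms by simp
  note fin = finite_card_le_of_bounded_sums[OF _ sum_gradient_le this mem]
  show "finite (G_index M f x \<epsilon>)" by (rule fin(1)) auto
  have "real (card (G_index M f x \<epsilon>)) \<le> gradient_budget / \<epsilon> ^ 2" by (rule fin(2)) auto
  then show "real (card (G_index M f x \<epsilon>)) \<le> gradient_budget * (1 / \<epsilon> ^ 2)" by simp
qed

lemma integrable_curv_cube: "integrable M (\<lambda>\<omega>. curv k \<omega> ^ 3)"
  using curv_nonneg curv_le
  by (intro integrable_const_bound[where B = "Lg ^ 3"]) (auto intro!: power_mono)

lemma H_index_bound:
  assumes "0 < \<epsilon>"
  shows "finite (H_index M f x \<epsilon>)"
    and "real (card (H_index M f x \<epsilon>)) \<le> total_decrease / curvature_decrease * (1 / \<epsilon> ^ 3)"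
proof -
  have mem: "\<epsilon> ^ 3 \<le> expectation (\<lambda>\<omega>. curv k \<omega> ^ 3)" if "k \<in> H_index M f x \<epsilon>" for k
    using that by (intro power_le_expectation_power[OF curv_measurable_M curv_nonneg integrable_curv_cube _ assms])
      (auto simp: H_index_def curv_def)
  have "0 < \<epsilon> ^ 3" using assms by simp
  note fin = finite_card_le_of_bounded_sums[OF expectation_curv_nonneg sum_curv_le this mem]
  show "finite (H_index M f x \<epsilon>)" by (rule fin(1))
  have "real (card (H_index M f x \<epsilon>)) \<le> total_decrease / curvature_decrease / \<epsilon> ^ 3" by (rule fin(2))
  then show "real (card (H_index M f x \<epsilon>)) \<le> total_decrease / curvature_decrease * (1 / \<epsilon> ^ 3)" by simp
qed

lemma expectation_lambda_min_ge:
  assumes "k \<notin> H_index M f x \<epsilon>" and "0 < \<epsilon>"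
  shows "- \<epsilon> \<le> expectation (\<lambda>\<omega>. lambda_min (hessian f (x k \<omega>)))"
proof -
  have c: "integrable M (curv k)"
    using integrable_lower_power[OF curv_measurable_M[of k] curv_nonneg integrable_curv_cube, of 1] by simp
  have l: "integrable M (\<lambda>\<omega>. lambda_min (hessian f (x k \<omega>)))"
    using abs_lambda_min_hessian_le[OF f_C2 grad_lipschitz]
    by (intro integrable_const_bound[where B = Lg]) auto
  have "(\<integral>\<^sup>+\<omega>. ennreal (curv k \<omega>) \<partial>M) = ennreal (expectation (curv k))"
    using c curv_nonneg by (intro nn_integral_eq_integral) auto
  moreover have "(\<integral>\<^sup>+\<omega>. ennreal (curv k \<omega>) \<partial>M) \<le> ennreal \<epsilon>"
    using assms(1) by (simp add: H_index_def curv_def not_less)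
  ultimately have "expectation (curv k) \<le> \<epsilon>" using assms(2) by simp
  moreover have "expectation (\<lambda>\<omega>. - curv k \<omega>) \<le> expectation (\<lambda>\<omega>. lambda_min (hessian f (x k \<omega>)))"
    using c l by (intro integral_mono) (auto simp: curv_def lambda_min_neg_def)
  ultimately show ?thesis by simp
qed

text \<open>Among the first \<open>card B + 1\<close> indices one lies outside the set \<open>B\<close> of bad ones. Counting from 0, this
  index is at most \<open>card B\<close>, so the bound holds without an additive constant.\<close>

lemma good_iterate_exists:
  assumes "0 < \<epsilon>g" and "0 < \<epsilon>H"
  shows "\<exists>k. real k \<le> (gradient_budget + total_decrease / curvature_decrease) * max (1 / \<epsilon>g ^ 2) (1 / \<epsilon>H ^ 3) \<and>
      (\<integral>\<^sup>+\<omega>. ennreal (norm (gradient f (x k \<omega>))) \<partial>M) \<le> ennreal \<epsilon>g \<and>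
      - \<epsilon>H \<le> expectation (\<lambda>\<omega>. lambda_min (hessian f (x k \<omega>)))"
proof -
  let ?B = "G_index M f x \<epsilon>g \<union> H_index M f x \<epsilon>H" and ?m = "max (1 / \<epsilon>g ^ 2) (1 / \<epsilon>H ^ 3)"
  have fin: "finite ?B" using assms G_index_bound(1) H_index_bound(1) by simp
  have "\<not> {..card ?B} \<subseteq> ?B"
    using card_mono[OF fin, of "{..card ?B}"] by auto
  then obtain k where k: "k \<le> card ?B" "k \<notin> ?B" by auto
  have nonneg: "0 \<le> gradient_budget" "0 \<le> total_decrease / curvature_decrease"
    using sum_gradient_le[of 0] sum_curv_le[of 0] by simp_all
  have "real k \<le> real (card (G_index M f x \<epsilon>g)) + real (card (H_index M f x \<epsilon>H))"
    using k(1) card_Un_le[of "G_index M f x \<epsilon>g" "H_index M f x \<epsilon>H"] by linarith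
  also have "\<dots> \<le> gradient_budget * (1 / \<epsilon>g ^ 2) + total_decrease / curvature_decrease * (1 / \<epsilon>H ^ 3)"
    using assms by (intro add_mono G_index_bound(2) H_index_bound(2))
  also have "\<dots> \<le> gradient_budget * ?m + total_decrease / curvature_decrease * ?m"
    using nonneg by (intro add_mono mult_left_mono) auto
  finally have "real k \<le> (gradient_budget + total_decrease / curvature_decrease) * ?m"
    by (simp only: distrib_right)
  moreover have "(\<integral>\<^sup>+\<omega>. ennreal (norm (gradient f (x k \<omega>))) \<partial>M) \<le> ennreal \<epsilon>g"
    using k(2) by (simp add: G_index_def not_less)
  moreover have "- \<epsilon>H \<le> expectation (\<lambda>\<omega>. lambda_min (hessian f (x k \<omega>)))"
    using k(2) assms(2) by (intro expectation_lambda_min_ge) auto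
  ultimately show ?thesis by blast
qed

end

theorem corollary3p14:
  fixes M :: "'w measure"
    and f :: "real^'n \<Rightarrow> real"
    and x0 :: "real^'n"
    and H :: "nat \<Rightarrow> 'w \<Rightarrow> real^'n^'n"
    and g q p ghat xhat x :: "nat \<Rightarrow> 'w \<Rightarrow> real^'n"
    and fbar Lg LH \<gamma> \<gamma>H \<gamma>l \<delta> \<theta> \<theta>hat \<alpha> \<beta> :: real
    and \<sigma> \<sigma>hat :: "nat \<Rightarrow> real"
  assumes "prob_space M"
    and "twice_continuously_differentiable f"
    and "0 < Lg" and "Lg-lipschitz_on UNIV (gradient f)"
    and "0 < LH" and "hessian_lipschitz LH f"
    and "\<forall>y. fbar \<le> f y"
    and "0 < \<gamma>" and "\<gamma> \<le> 1"
    and "0 \<le> \<gamma>H" and "\<gamma>H < \<gamma>"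
    and "0 \<le> \<gamma>l" and "\<gamma>l < 1"
    and "\<gamma>H < \<gamma> * (1 - \<gamma>l)"
    and "0 < \<delta>"
    and "0 \<le> \<theta>" and "\<theta> < 1"
    and "0 \<le> \<theta>hat"
    and "\<forall>k. 0 < \<sigma> k" and "summable (\<lambda>k. (\<sigma> k)\<^sup>2)"
    and "\<forall>k. 0 < \<sigma>hat k" and "summable (\<lambda>k. (\<sigma>hat k)\<^sup>2)"
    and "0 < \<alpha>" and "\<alpha> \<le> 1 / (Lg * (1 + \<theta>hat\<^sup>2))"
    and "0 < \<beta>" and "\<beta> \<le> 3 * (\<gamma> - \<gamma>H / (1 - \<gamma>l)) / (2 * \<delta> * LH)"
    and "two_step_method M (\<lambda>_. \<alpha>) (\<lambda>_. \<beta>) x0 H p ghat xhat x"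
    and "condition_A M f \<gamma> \<delta> (\<lambda>_. \<theta>) \<sigma> H g q p x"
    and "condition_B M f \<gamma>H \<gamma>l H p x"
    and "condition_C M f (\<lambda>_. \<theta>hat) \<sigma>hat ghat xhat x"
  shows "(\<exists>C. \<forall>\<epsilon>g>0. finite (G_index M f x \<epsilon>g) \<and>
              real (card (G_index M f x \<epsilon>g)) \<le> C * (1 / \<epsilon>g ^ 2)) \<and>
         (\<exists>C. \<forall>\<epsilon>H>0. finite (H_index M f x \<epsilon>H) \<and>
              real (card (H_index M f x \<epsilon>H)) \<le> C * (1 / \<epsilon>H ^ 3)) \<and>
         (\<exists>C. \<forall>\<epsilon>g>0. \<forall>\<epsilon>H>0. \<exists>k.
              real k \<le> C * max (1 / \<epsilon>g ^ 2) (1 / \<epsilon>H ^ 3) \<and>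
              (\<integral>\<^sup>+\<omega>. ennreal (norm (gradient f (x k \<omega>))) \<partial>M) \<le> ennreal \<epsilon>g \<and>
              (\<integral>\<omega>. lambda_min (hessian f (x k \<omega>)) \<partial>M) \<ge> - \<epsilon>H)"
proof -
  interpret two_step_run M f x0 H g q p ghat xhat x fbar Lg LH \<gamma> \<gamma>H \<gamma>l \<delta> \<theta> \<theta>hat \<alpha> \<beta> \<sigma> \<sigma>hat
    unfolding two_step_run_def two_step_run_axioms_def using assms by blast
  have "\<forall>\<epsilon>g>0. finite (G_index M f x \<epsilon>g) \<and>
      real (card (G_index M f x \<epsilon>g)) \<le> gradient_budget * (1 / \<epsilon>g ^ 2)"
    using G_index_bound by blast
  moreover have "\<forall>\<epsilon>H>0. finite (H_index M f x \<epsilon>H) \<and>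
      real (card (H_index M f x \<epsilon>H)) \<le> total_decrease / curvature_decrease * (1 / \<epsilon>H ^ 3)"
    using H_index_bound by blast
  moreover have "\<forall>\<epsilon>g>0. \<forall>\<epsilon>H>0. \<exists>k.
      real k \<le> (gradient_budget + total_decrease / curvature_decrease) * max (1 / \<epsilon>g ^ 2) (1 / \<epsilon>H ^ 3) \<and>
      (\<integral>\<^sup>+\<omega>. ennreal (norm (gradient f (x k \<omega>))) \<partial>M) \<le> ennreal \<epsilon>g \<and>
      (\<integral>\<omega>. lambda_min (hessian f (x k \<omega>)) \<partial>M) \<ge> - \<epsilon>H"
    using good_iterate_exists by blast
  ultimately show ?thesis by (intro conjI exI)
qed

end
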